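(* Let $k\ge2$. Grow random $k$-Stirling permutations by the random insertion process described in the context, and let $\tilde K_{n,1},\tilde K_{n,2},\dots$ be the block sizes of the permutation of order $n$, with blocks ordered by their labels as described in the context. Then there exist independent random variables $\beta_m\sim\mathrm{Beta}\bigl(\frac{k-1}{k},\frac{m+1}{k}\bigr)$, $m\ge1$, such that \[ \frac1{kn}(\tilde K_{n,1},\tilde K_{n,2},\dots)\xrightarrow{a.s.}\bigl(\beta_1,(1-\beta_1)\beta_2,(1-\beta_1)(1-\beta_2)\beta_3,\dots\bigr) \] (componentwise, equivalently in $\ell^1$).
   Context: A $k$-Stirling permutation of order $n$ is a word $a_1\cdots a_{kn}$ in which each of $1,\dots,n$ occurs exactly $k$ times, such that for each $i$ every entry between two occurrences of $i$ is at least $i$. A block is a substring $a_p\cdots a_q$ ($p\le q$) with $a_p=a_q$ not contained in any strictly larger such substring; every block begins and ends with the same value, called its label. Order the blocks as $\tilde{\mathcal K}_1,\dots,\tilde{\mathcal K}_s$ by increasing label ($s$ = number of blocks), let $\tilde K_i$ be the length of $\tilde{\mathcal K}_i$, and set $\tilde K_i=0$ for $i>s$. Growth process: start with $1^k$; given a permutation of order $n$, insert the string $(n+1)^k$ into one of its $kn+1$ gaps (including first and last positions) chosen uniformly at random. *)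

theory Defs
  imports "HOL-Probability.Probability"
begin

definition k_stirling :: "nat \<Rightarrow> nat \<Rightarrow> nat list \<Rightarrow> bool" where
  "k_stirling k n w \<longleftrightarrow>
     set w \<subseteq> {1..n} \<and> (\<forall>i\<in>{1..n}. count_list w i = k) \<and>
     (\<forall>p q r. p < q \<and> q < r \<and> r < length w \<and> w ! p = w ! r \<longrightarrow> w ! p \<le> w ! q)"

definition insert_run :: "nat \<Rightarrow> nat \<Rightarrow> nat \<Rightarrow> nat list \<Rightarrow> nat list" where
  "insert_run k m g w = take g w @ replicate k m @ drop g w"

text \<open>
  \<open>u n\<close> is the gap of the permutation of order \<open>n\<close> into which the run of \<open>n + 1\<close> is inserted, i.e.
  the number of letters to the left of that gap; it is meant to lie in \<open>{0..k * n}\<close>. The process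
  starts at order 1; the value at order 0 is a dummy.
\<close>

fun stirling_growth :: "nat \<Rightarrow> (nat \<Rightarrow> nat) \<Rightarrow> nat \<Rightarrow> nat list" where
  "stirling_growth k u 0 = []"
| "stirling_growth k u (Suc 0) = replicate k 1"
| "stirling_growth k u (Suc (Suc n)) =
     insert_run k (Suc (Suc n)) (u (Suc n)) (stirling_growth k u (Suc n))"

lemma k_stirling_insert_run:
  assumes "k_stirling k n w"
  shows "k_stirling k (Suc n) (insert_run k (Suc n) g w)"
proof -
  define h where "h = min g (length w)"
  have *: "insert_run k (Suc n) g w = take h w @ replicate k (Suc n) @ drop h w"
    unfolding insert_run_def h_def by (simp add: min_def)
  have hl: "h \<le> length w" by (simp add: h_def)
  let ?v = "take h w @ replicate k (Suc n) @ drop h w"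
  have sw: "set w \<subseteq> {1..n}" and cw: "\<And>i. i \<in> {1..n} \<Longrightarrow> count_list w i = k"
    and bw: "\<And>p q r. \<lbrakk>p < q; q < r; r < length w; w ! p = w ! r\<rbrakk> \<Longrightarrow> w ! p \<le> w ! q"
    using assms by (auto simp: k_stirling_def)
  have cnt: "count_list ?v i = count_list w i + (if i = Suc n then k else 0)" for i
  proof -
    have "count_list (replicate k (Suc n)) i = (if i = Suc n then k else 0)"
      by (induction k) auto
    moreover have "count_list w i = count_list (take h w) i + count_list (drop h w) i"
      by (metis append_take_drop_id count_list_append)
    ultimately show ?thesis by simp
  qed
  have 1: "set ?v \<subseteq> {1..Suc n}"
    using sw by (auto dest!: in_set_takeD in_set_dropD)
  have 2: "count_list ?v i = k" if "i \<in> {1..Suc n}" for i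
  proof (cases "i = Suc n")
    case True
    then have "i \<notin> set w" using sw by auto
    then show ?thesis using True by (simp only: cnt) simp
  next
    case False
    then show ?thesis using that cw[of i] by (simp only: cnt) simp
  qed
  have nv: "?v ! p = (if p < h then w ! p else if p < h + k then Suc n else w ! (p - k))"
    if "p < length w + k" for p
    using that hl by (auto simp: nth_append min_def)
  have le: "w ! p < Suc n" if "p < length w" for p
    using sw that nth_mem by fastforce
  have 3: "?v ! p \<le> ?v ! q" if "p < q" "q < r" "r < length ?v" "?v ! p = ?v ! r" for p q r
  proof -
    have r: "r < length w + k" using that by simp
    then have pq: "p < length w + k" "q < length w + k" using that by auto
    note nv' = nv[OF r] nv[OF pq(1)] nv[OF pq(2)]
    define f where "f p = (if p < h then p else p - k)" for p
    have fl: "w ! f x < Suc n" if "x < length w + k" "\<not> (h \<le> x \<and> x < h + k)" for x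
      using that hl by (intro le) (auto simp: f_def)
    show ?thesis
    proof (cases "h \<le> q \<and> q < h + k")
      case True
      have "?v ! p \<in> set ?v"
        by (rule nth_mem) (use pq hl in simp)
      then have "?v ! p \<le> Suc n" using 1 by auto
      then show ?thesis using nv' True by simp
    next
      case q: False
      show ?thesis
      proof (cases "(h \<le> p \<and> p < h + k) \<or> (h \<le> r \<and> r < h + k)")
        case True
        have "(h \<le> p \<and> p < h + k) \<and> (h \<le> r \<and> r < h + k)"
          using True that(4) nv' fl[OF r] fl[OF pq(1)]
          by (auto simp: f_def split: if_splits)
        then show ?thesis using q that by auto
      next
        case False
        then have "w ! f p \<le> w ! f q"
          using that q nv' r pq hl by (intro bw[of _ _ "f r"]) (auto simp: f_def)
        then show ?thesis using nv' False q by (auto simp: f_def)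
      qed
    qed
  qed
  show ?thesis
    unfolding * k_stirling_def using 1 2 3 by blast
qed

lemma k_stirling_growth: "k_stirling k n (stirling_growth k u n)"
proof (induction k u n rule: stirling_growth.induct)
  case (2 k u)
  have "count_list (replicate k (1::nat)) 1 = k" by (induction k) auto
  then show ?case by (auto simp: k_stirling_def)
qed (simp_all add: k_stirling_def[of _ 0] k_stirling_insert_run del: One_nat_def)

text \<open>A substring is represented by the pair of (0-based) positions of its ends.\<close>

definition closed_substrings :: "nat list \<Rightarrow> (nat \<times> nat) set" where
  "closed_substrings w = {(p, q). p \<le> q \<and> q < length w \<and> w ! p = w ! q}"

definition blocks :: "nat list \<Rightarrow> (nat \<times> nat) set" where
  "blocks w = {(p, q) \<in> closed_substrings w.
     \<forall>(p', q') \<in> closed_substrings w. {p..q} \<subseteq> {p'..q'} \<longrightarrow> (p', q') = (p, q)}"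

definition block_label :: "nat list \<Rightarrow> nat \<times> nat \<Rightarrow> nat" where
  "block_label w = (\<lambda>(p, q). w ! p)"

definition block_length :: "nat \<times> nat \<Rightarrow> nat" where
  "block_length = (\<lambda>(p, q). q - p + 1)"

definition ordered_blocks :: "nat list \<Rightarrow> (nat \<times> nat) list" where
  "ordered_blocks w = sorted_key_list_of_set (block_label w) (blocks w)"

lemma finite_blocks: "finite (blocks w)"
  by (rule finite_subset[of _ "{..<length w} \<times> {..<length w}"])
     (auto simp: blocks_def closed_substrings_def)

lemma inj_on_block_label: "inj_on (block_label w) (blocks w)"
proof (rule inj_onI, clarify)
  fix p q p' q'
  assume a: "(p, q) \<in> blocks w" "(p', q') \<in> blocks w"
    and eq: "block_label w (p, q) = block_label w (p', q')"
  have "(min p p', max q q') \<in> closed_substrings w"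
    using a eq by (auto simp: blocks_def closed_substrings_def block_label_def min_def max_def)
  then have "(min p p', max q q') = (p, q)" "(min p p', max q q') = (p', q')"
    using a unfolding blocks_def by fastforce+
  then show "p = p' \<and> q = q'" by auto
qed

lemma (in linorder) sorted_key_list_of_set_inj_on:
  assumes "inj_on f A" "finite A"
  shows "set (sorted_key_list_of_set f A) = A"
    and "sorted_wrt (<) (map f (sorted_key_list_of_set f A))"
proof -
  interpret folding_insort_key "(\<le>)" "(<)" A f
    by unfold_locales (rule assms(1))
  show "set (sorted_key_list_of_set f A) = A"
    and "sorted_wrt (<) (map f (sorted_key_list_of_set f A))"
    using assms(2) by auto
qed

text \<open>Labels of distinct blocks are distinct, so \<^const>\<open>ordered_blocks\<close> lists every block exactly once.\<close>

lemma ordered_blocks: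
  "set (ordered_blocks w) = blocks w"
  "sorted_wrt (<) (map (block_label w) (ordered_blocks w))"
  unfolding ordered_blocks_def
  by (rule sorted_key_list_of_set_inj_on[OF inj_on_block_label finite_blocks])+

text \<open>The index \<open>i\<close> is 1-based; the value at \<open>i = 0\<close> is a dummy.\<close>

definition block_size :: "nat list \<Rightarrow> nat \<Rightarrow> nat" where
  "block_size w i =
     (if 1 \<le> i \<and> i \<le> length (ordered_blocks w)
      then block_length (ordered_blocks w ! (i - 1)) else 0)"

definition beta_density :: "real \<Rightarrow> real \<Rightarrow> real \<Rightarrow> real" where
  "beta_density a b x =
     (if 0 < x \<and> x < 1 then x powr (a - 1) * (1 - x) powr (b - 1) / Beta a b else 0)"

definition stick_breaking :: "(nat \<Rightarrow> real) \<Rightarrow> nat \<Rightarrow> real" where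
  "stick_breaking b i = (\<Prod>j\<in>{1..<i}. 1 - b j) * b i"

text \<open>
  Convergence in \<open>\<ell>\<^sup>1\<close> of sequences indexed by \<open>1, 2, \<dots>\<close>. Summability is demanded explicitly, as
  \<^const>\<open>suminf\<close> is unspecified on divergent series.
\<close>

definition tendsto_l1 :: "(nat \<Rightarrow> nat \<Rightarrow> real) \<Rightarrow> (nat \<Rightarrow> real) \<Rightarrow> bool" where
  "tendsto_l1 x y \<longleftrightarrow>
     (\<forall>n. summable (\<lambda>i. \<bar>x n (Suc i)\<bar>)) \<and> summable (\<lambda>i. \<bar>y (Suc i)\<bar>) \<and>
     (\<lambda>n. \<Sum>i. \<bar>x n (Suc i) - y (Suc i)\<bar>) \<longlonglongrightarrow> 0"

end

theory Submission
  imports Defs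
begin

text \<open>
  The blocks follow a Chinese restaurant process: the run of \<open>n + 1\<close> either enlarges the
  block containing the chosen gap by \<open>k\<close> letters, which happens with probability
  \<open>(size - 1) / (k * n + 1)\<close>, or it becomes a new last block. The sequence of growing blocks
  is therefore a sequence of natural numbers whose prefixes have explicit product probabilities.
  Following Pitman, the same prefix probabilities arise from a mixture: draw independent Beta variables
  \<open>v 0, v 1, ...\<close>, break the unit interval into sticks, throw independent uniform points and
  let each point grow the block of its stick, opening the next new block if the point lies beyond the
  sticks already in use. For fixed \<open>v\<close> a prefix has probability \<open>\<Prod>i. v i ^ p i *
  (1 - v i) ^ q i\<close>, and the resulting Beta moments telescope to the urn probabilities. In the
  mixture the strong law of large numbers shows that the block frequencies converge to the stick lengths,
  from which the \<open>v i\<close> can be recovered; since this is a property of the law of the sequence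
  alone, it carries over to the growth process.
\<close>

section \<open>Blocks under insertion of a run\<close>

text \<open>The restaurant has discount and strength both equal to 1/k: after division by k the step
  probabilities are (x - 1/k)/(n + 1/k) for a block visited x times and ((s + 1)/k)/(n + 1/k) for a
  new block after s others. For these parameters the m-th stick is Beta(1 - 1/k, 1/k + m/k), the law
  in the theorem. A new block is opened by a point anywhere beyond the sticks in use and is then
  identified with the next stick, so the first visit to a stick carries no factor
  \<open>v i\<close>: the exponent of \<open>v i\<close> is the number of visits minus one. The
  obstacle is that the Beta variables have to live on the given space, which need not carry any
  randomness beyond the gaps. They are therefore defined as measurable functions of the path, and
  their joint law is read off from the law of the path. Componentwise convergence yields convergence
  in l1 because no mass is lost: the unbroken length tends to 0 almost surely, so that the
  frequencies and their limits both sum to 1.\<close>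

definition shift_pos :: "nat \<Rightarrow> nat \<Rightarrow> nat \<Rightarrow> nat" where
  "shift_pos k g x = (if x < g then x else x + k)"

text \<open>Gap g lies between positions g - 1 and g. The two gaps at the ends of a block do not
  count as inside, so a block of length l has l - 1 inner gaps.\<close>

definition gap_inside :: "nat \<Rightarrow> nat \<times> nat \<Rightarrow> bool" where
  "gap_inside g = (\<lambda>(p, q). p < g \<and> g \<le> q)"

text \<open>If the gap is in no block, the value is the index that the new block will receive, since
  its label is the largest. In a Stirling permutation at most one block contains the gap, and then
  \<open>LEAST\<close> makes no choice.\<close>

definition grow_index :: "nat list \<Rightarrow> nat \<Rightarrow> nat" where
  "grow_index w g =
     (if \<exists>i<length (ordered_blocks w). gap_inside g (ordered_blocks w ! i)
      then LEAST i. i < length (ordered_blocks w) \<and> gap_inside g (ordered_blocks w ! i)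
      else length (ordered_blocks w))"

lemma blocksD:
  assumes "(p, q) \<in> blocks w"
  shows "p \<le> q" "q < length w" "w ! p = w ! q"
  using assms by (auto simp: blocks_def closed_substrings_def)

lemma blocks_maximal:
  assumes "(p, q) \<in> blocks w" "(p', q') \<in> closed_substrings w" "p' \<le> p" "q \<le> q'"
  shows "p' = p" "q' = q"
proof -
  have "{p..q} \<subseteq> {p'..q'}" using assms(3,4) by auto
  then have "(p', q') = (p, q)" using assms(1,2) unfolding blocks_def by fastforce
  then show "p' = p" "q' = q" by auto
qed

lemma blocksI:
  assumes "(p, q) \<in> closed_substrings w"
    and "\<And>p' q'. (p', q') \<in> closed_substrings w \<Longrightarrow> p' \<le> p \<Longrightarrow> q \<le> q' \<Longrightarrow> p' = p \<and> q' = q"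
  shows "(p, q) \<in> blocks w"
proof -
  have "p \<le> q" using assms(1) by (auto simp: closed_substrings_def)
  then have "p' \<le> p \<and> q \<le> q'" if "{p..q} \<subseteq> {p'..q'}" for p' q'
    using that by auto
  then show ?thesis using assms unfolding blocks_def by blast
qed

text \<open>Among the closed substrings around the given one, a longest exists because lengths are
  bounded, and a longest one is maximal for inclusion.\<close>

lemma closed_substring_in_block:
  assumes "(p, q) \<in> closed_substrings w"
  obtains p' q' where "(p', q') \<in> blocks w" "p' \<le> p" "q \<le> q'"
proof -
  define P where "P = (\<lambda>(p', q'). (p', q') \<in> closed_substrings w \<and> p' \<le> p \<and> q \<le> q')"
  have "\<exists>x. P x \<and> (\<forall>y. P y \<longrightarrow> (\<lambda>(p, q). q - p) y \<le> (\<lambda>(p, q). q - p) x)"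
  proof (rule ex_has_greatest_nat)
    show "P (p, q)" using assms by (simp add: P_def)
    show "\<forall>y. P y \<longrightarrow> (\<lambda>(p, q). q - p) y < length w + 1"
      by (auto simp: P_def closed_substrings_def)
  qed
  then obtain p' q' where P: "P (p', q')"
    and max: "\<And>p'' q''. P (p'', q'') \<Longrightarrow> q'' - p'' \<le> q' - p'" by auto
  have "(p', q') \<in> blocks w"
  proof (rule blocksI)
    show "(p', q') \<in> closed_substrings w" using P by (simp add: P_def)
    fix a b assume ab: "(a, b) \<in> closed_substrings w" "a \<le> p'" "q' \<le> b"
    then have "b - a \<le> q' - p'" using P by (intro max) (auto simp: P_def)
    moreover have "p' \<le> q'" using P by (auto simp: P_def closed_substrings_def)
    ultimately show "a = p' \<and> b = q'" using ab by linarith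
  qed
  then show ?thesis using P that by (auto simp: P_def)
qed

text \<open>If the blocks overlapped, maximality would give q < q'. The Stirling condition in the
  first block gives \<open>w ! p \<le> w ! p'\<close>, in the second
  \<open>w ! p' \<le> w ! q\<close>. So all four ends carry one value, and (p, q') is a closed
  substring larger than both blocks.\<close>

lemma blocks_disjoint:
  assumes "k_stirling k n w" "(p, q) \<in> blocks w" "(p', q') \<in> blocks w" "p < p'"
  shows "q < p'"
proof (rule ccontr)
  assume "\<not> q < p'"
  then have le: "p' \<le> q" by simp
  have st: "w ! a \<le> w ! b" if "a < b" "b < c" "c < length w" "w ! a = w ! c" for a b c
    using assms(1) that by (auto simp: k_stirling_def)
  note D = blocksD[OF assms(2)] blocksD[OF assms(3)]
  have "q < q'"
  proof (rule ccontr)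
    assume "\<not> q < q'"
    then have "p = p'" using D assms(2,4)
      by (intro blocks_maximal(1)[OF assms(3)]) (auto simp: blocks_def)
    then show False using assms(4) by simp
  qed
  have "w ! p \<le> w ! p'"
    by (cases "p' = q") (use D le assms(4) st[of p p' q] in auto)
  moreover have "w ! p' \<le> w ! q"
    by (cases "p' = q") (use D le \<open>q < q'\<close> st[of p' q q'] in auto)
  ultimately have "(p, q') \<in> closed_substrings w"
    using D assms(4) by (auto simp: closed_substrings_def)
  then have "p = p'" by (rule blocks_maximal(1)[OF assms(3)]) (use assms(4) in auto)
  then show False using assms(4) by simp
qed

lemma gap_inside_unique:
  assumes "k_stirling k n w" "B \<in> blocks w" "B' \<in> blocks w" "gap_inside g B" "gap_inside g B'"
  shows "B = B'"
proof -
  obtain p q p' q' where eq: "B = (p, q)" "B' = (p', q')" by force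
  note B = assms(2,3)[unfolded eq]
  have "p = p'"
    using blocks_disjoint[OF assms(1) B(1) B(2)] blocks_disjoint[OF assms(1) B(2) B(1)] assms(4,5) eq
    by (cases p p' rule: linorder_cases) (auto simp: gap_inside_def)
  then have "block_label w B = block_label w B'" by (simp add: eq block_label_def)
  then show ?thesis using inj_on_block_label assms(2,3) by (auto dest: inj_onD)
qed

lemma insert_run_min: "insert_run k m g w = insert_run k m (min g (length w)) w"
  by (simp add: insert_run_def min_def)

lemma length_insert_run [simp]: "length (insert_run k m g w) = length w + k"
  by (simp add: insert_run_def min_def)

lemma nth_insert_run:
  assumes "g \<le> length w" "p < length w + k"
  shows "insert_run k m g w ! p =
    (if p < g then w ! p else if p < g + k then m else w ! (p - k))"
  using assms by (auto simp: insert_run_def nth_append)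


lemma shift_pos_cases:
  assumes "p < length w + k" "g \<le> length w"
  obtains x where "x < length w" "p = shift_pos k g x" | "g \<le> p" "p < g + k"
proof (cases "p < g")
  case True
  then show ?thesis using that(1)[of p] assms(2) by (simp add: shift_pos_def)
next
  case False
  then show ?thesis
    using assms that(2) that(1)[of "p - k"] by (cases "p < g + k") (auto simp: shift_pos_def)
qed

lemma shift_pos_mono [simp]: "shift_pos k g x \<le> shift_pos k g y \<longleftrightarrow> x \<le> y"
  by (auto simp: shift_pos_def)

lemma shift_pos_eq [simp]: "shift_pos k g x = shift_pos k g y \<longleftrightarrow> x = y"
  by (auto simp: shift_pos_def)

lemma shift_pos_less: "x < n \<Longrightarrow> shift_pos k g x < n + k"
  by (auto simp: shift_pos_def)

lemma nth_insert_run_shift: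
  assumes "g \<le> length w" "x < length w"
  shows "insert_run k m g w ! shift_pos k g x = w ! x"
  using assms by (auto simp: nth_insert_run shift_pos_def)

text \<open>The inserted letter exceeds all old ones, so the two equal ends of a closed substring
  are both old or both in the run.\<close>

lemma closed_substrings_insert_run:
  assumes "g \<le> length w" "\<forall>x\<in>set w. x < m"
  shows "closed_substrings (insert_run k m g w) =
    map_prod (shift_pos k g) (shift_pos k g) ` closed_substrings w \<union>
    {(p, q). g \<le> p \<and> p \<le> q \<and> q < g + k}" (is "?L = ?R")
proof (rule set_eqI, clarify)
  fix p q
  let ?v = "insert_run k m g w"
  have lt: "w ! x < m" if "x < length w" for x using assms(2) that by auto
  show "(p, q) \<in> ?L \<longleftrightarrow> (p, q) \<in> ?R"
  proof
    assume "(p, q) \<in> ?L"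
    then have pq: "p \<le> q" "q < length w + k" "?v ! p = ?v ! q"
      by (auto simp: closed_substrings_def)
    then have p: "p < length w + k" by simp
    from p assms(1) show "(p, q) \<in> ?R"
    proof (cases rule: shift_pos_cases)
      case (1 x)
      from pq(2) assms(1) show ?thesis
      proof (cases rule: shift_pos_cases)
        case (1 y)
        then show ?thesis using \<open>p = shift_pos k g x\<close> \<open>x < length w\<close> pq assms
          by (intro UnI1 image_eqI[of _ _ "(x, y)"])
             (auto simp: closed_substrings_def nth_insert_run_shift)
      next
        case 2
        then have "w ! x = m" using 1 pq assms
          by (simp add: nth_insert_run_shift) (simp add: nth_insert_run)
        then show ?thesis using lt[of x] 1 by simp
      qed
    next
      case 2
      from pq(2) assms(1) show ?thesis
      proof (cases rule: shift_pos_cases)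
        case (1 y)
        then have "m = w ! y" using 2 pq(3) p assms
          by (simp add: nth_insert_run_shift) (simp add: nth_insert_run)
        then show ?thesis using lt[of y] 1 by simp
      next
        case 2
        then show ?thesis using \<open>g \<le> p\<close> pq by auto
      qed
    qed
  next
    assume "(p, q) \<in> ?R"
    then show "(p, q) \<in> ?L"
      using assms shift_pos_less[of _ "length w" k g]
      by (auto simp: closed_substrings_def nth_insert_run_shift) (auto simp: nth_insert_run)
  qed
qed

lemma closed_substrings_insert_runE:
  assumes "(p, q) \<in> closed_substrings (insert_run k m g w)" "g \<le> length w" "\<forall>x\<in>set w. x < m"
  obtains x y where "(x, y) \<in> closed_substrings w" "p = shift_pos k g x" "q = shift_pos k g y"
    | "g \<le> p" "p \<le> q" "q < g + k"
proof -
  have "(p, q) \<in> map_prod (shift_pos k g) (shift_pos k g) ` closed_substrings w \<or>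
      (g \<le> p \<and> p \<le> q \<and> q < g + k)"
    using assms(1) unfolding closed_substrings_insert_run[OF assms(2,3)] by blast
  then show ?thesis
  proof
    assume "(p, q) \<in> map_prod (shift_pos k g) (shift_pos k g) ` closed_substrings w"
    then obtain B where B: "B \<in> closed_substrings w"
      "(p, q) = map_prod (shift_pos k g) (shift_pos k g) B" by (rule imageE) simp
    obtain x y where "B = (x, y)" by force
    then show ?thesis using B by (intro that(1)[of x y]) simp_all
  next
    assume "g \<le> p \<and> p \<le> q \<and> q < g + k"
    then show ?thesis by (intro that(2)) simp_all
  qed
qed

lemma shift_pos_ivl:
  assumes "0 < k"
  shows "shift_pos k g p \<le> g \<and> g + k - 1 \<le> shift_pos k g q \<longleftrightarrow> gap_inside g (p, q)"
  using assms by (auto simp: shift_pos_def gap_inside_def)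

text \<open>Shifting preserves and reflects inclusion, so maximality among old substrings is
  unaffected. The full run is the largest of the new substrings, and it is maximal unless a shifted
  old one covers it, that is, unless the gap is inside some block.\<close>

lemma blocks_insert_run:
  assumes "g \<le> length w" "\<forall>x\<in>set w. x < m" "0 < k"
  shows "blocks (insert_run k m g w) =
    map_prod (shift_pos k g) (shift_pos k g) ` blocks w \<union>
    (if \<exists>B\<in>blocks w. gap_inside g B then {} else {(g, g + k - 1)})" (is "?L = ?R")
proof (rule set_eqI, clarify)
  fix p q
  let ?v = "insert_run k m g w" and ?s = "shift_pos k g"
  note cs = closed_substrings_insert_run[OF assms(1,2), of k]
  have run_not: "\<not> (g \<le> ?s x \<and> ?s x < g + k)" for x
    by (auto simp: shift_pos_def)
  show "(p, q) \<in> ?L \<longleftrightarrow> (p, q) \<in> ?R"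
  proof
    assume L: "(p, q) \<in> ?L"
    then have "(p, q) \<in> closed_substrings ?v" by (auto simp: blocks_def)
    then consider x y where "(x, y) \<in> closed_substrings w" "p = ?s x" "q = ?s y"
      | "g \<le> p" "p \<le> q" "q < g + k"
      by (rule closed_substrings_insert_runE[OF _ assms(1,2)])
    then show "(p, q) \<in> ?R"
    proof cases
      case 1
      have "(x, y) \<in> blocks w"
      proof (rule blocksI[OF 1(1)])
        fix x' y' assume *: "(x', y') \<in> closed_substrings w" "x' \<le> x" "y \<le> y'"
        then have "(?s x', ?s y') \<in> closed_substrings ?v" unfolding cs by auto
        from blocks_maximal[OF L this] * 1 show "x' = x \<and> y' = y" by simp
      qed
      then show ?thesis using 1 by auto
    next
      case 2
      have c: "(g, g + k - 1) \<in> closed_substrings ?v" unfolding cs using assms(3) by auto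
      have "q \<le> g + k - 1" using 2 by simp
      from blocks_maximal[OF L c 2(1) this] have pq: "p = g" "q = g + k - 1" by auto
      have "\<not> gap_inside g (x, y)" if "(x, y) \<in> blocks w" for x y
      proof
        assume *: "gap_inside g (x, y)"
        have "(x, y) \<in> closed_substrings w" using that by (auto simp: blocks_def)
        then have "(?s x, ?s y) \<in> closed_substrings ?v" unfolding cs by auto
        \<comment> \<open>The shifted block would have to coincide with the run, but no shifted
          position falls into the run.\<close>
        from blocks_maximal[OF L this] * have "?s x = g"
          using pq shift_pos_ivl[OF assms(3), of g x y] by auto
        then show False using run_not[of x] assms(3) by simp
      qed
      then have "\<not> (\<exists>B\<in>blocks w. gap_inside g B)" by auto
      then show ?thesis unfolding pq by (simp only: if_False Un_iff singleton_iff simp_thms)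
    qed
  next
    assume "(p, q) \<in> ?R"
    then have R: "(p, q) \<in> map_prod ?s ?s ` blocks w \<or>
        (p, q) \<in> (if \<exists>B\<in>blocks w. gap_inside g B then {} else {(g, g + k - 1)})"
      by (rule Un_iff[THEN iffD1])
    show "(p, q) \<in> ?L"
    proof (cases "(p, q) \<in> map_prod ?s ?s ` blocks w")
      case True
      then obtain B where "B \<in> blocks w" "(p, q) = map_prod ?s ?s B" by (rule imageE) simp
      then obtain x y where 1: "(x, y) \<in> blocks w" "p = ?s x" "q = ?s y" by (cases B) simp
      have xy: "(x, y) \<in> closed_substrings w" "x \<le> y"
        using 1(1) blocksD(1)[OF 1(1)] by (auto simp: blocks_def)
      show ?thesis unfolding 1(2,3)
      proof (rule blocksI)
        show "(?s x, ?s y) \<in> closed_substrings ?v" using xy unfolding cs by auto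
        fix p' q' assume *: "(p', q') \<in> closed_substrings ?v" "p' \<le> ?s x" "?s y \<le> q'"
        from *(1) consider x' y' where "(x', y') \<in> closed_substrings w" "p' = ?s x'" "q' = ?s y'"
          | "g \<le> p'" "p' \<le> q'" "q' < g + k"
          by (rule closed_substrings_insert_runE[OF _ assms(1,2)])
        then show "p' = ?s x \<and> q' = ?s y"
        proof cases
          case 1
          then show ?thesis using * blocks_maximal[OF \<open>(x, y) \<in> blocks w\<close> 1(1)] by simp
        next
          case 2
          have "?s x \<le> ?s y" using xy by simp
          then have "g \<le> ?s x \<and> ?s x < g + k" using 2 * by linarith
          then show ?thesis using run_not by blast
        qed
      qed
    next
      case False
      have not_in: "\<not> (\<exists>B\<in>blocks w. gap_inside g B)"
      proof
        assume "\<exists>B\<in>blocks w. gap_inside g B"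
        then show False using R False by (simp only: if_True empty_iff simp_thms)
      qed
      then have 2: "(p, q) = (g, g + k - 1)"
        using R False by (simp only: if_False singleton_iff simp_thms)
      show ?thesis unfolding 2
      proof (rule blocksI)
        show "(g, g + k - 1) \<in> closed_substrings ?v" unfolding cs using assms(3) by auto
        fix p' q' assume *: "(p', q') \<in> closed_substrings ?v" "p' \<le> g" "g + k - 1 \<le> q'"
        from *(1) consider x' y' where "(x', y') \<in> closed_substrings w" "p' = ?s x'" "q' = ?s y'"
          | "g \<le> p'" "p' \<le> q'" "q' < g + k"
          by (rule closed_substrings_insert_runE[OF _ assms(1,2)])
        then show "p' = g \<and> q' = g + k - 1"
        proof cases
          case 1
          then have in1: "gap_inside g (x', y')" using * shift_pos_ivl[OF assms(3)] by auto
          \<comment> \<open>\<open>not_in\<close> speaks of blocks only, so the closed substring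
            around the gap is first enlarged to a block.\<close>
          obtain a b where ab: "(a, b) \<in> blocks w" "a \<le> x'" "y' \<le> b"
            using closed_substring_in_block[OF 1(1)] .
          then have "gap_inside g (a, b)" using in1 by (auto simp: gap_inside_def)
          then show ?thesis using not_in ab by blast
        next
          case 2
          then show ?thesis using * by auto
        qed
      qed
    qed
  qed
qed

lemma ordered_blocks_unique:
  assumes "set bs = blocks w" "sorted_wrt (<) (map (block_label w) bs)"
  shows "ordered_blocks w = bs"
proof -
  have eq: "map (block_label w) (ordered_blocks w) = map (block_label w) bs"
    using assms ordered_blocks[of w]
    by (intro sorted_distinct_set_unique) (auto simp: strict_sorted_iff simp del: sorted_map)
  show ?thesis
    using eq inj_on_block_label[of w] ordered_blocks(1)[of w] assms(1)
    by (intro map_inj_on[OF eq]) simp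
qed

lemma nth_ordered_blocks: "i < length (ordered_blocks w) \<Longrightarrow> ordered_blocks w ! i \<in> blocks w"
  using ordered_blocks(1) nth_mem by blast

lemma distinct_ordered_blocks: "distinct (ordered_blocks w)"
  using ordered_blocks(2)[of w] by (auto simp: strict_sorted_iff distinct_map simp del: sorted_map)

lemma grow_index_less_iff:
  "grow_index w g < length (ordered_blocks w) \<longleftrightarrow> (\<exists>B\<in>blocks w. gap_inside g B)"
proof -
  have "(\<exists>B\<in>blocks w. gap_inside g B) \<longleftrightarrow>
    (\<exists>i<length (ordered_blocks w). gap_inside g (ordered_blocks w ! i))"
    unfolding ordered_blocks(1)[of w, symmetric] by (simp only: Bex_def in_set_conv_nth) blast
  moreover have "(LEAST i. i < length (ordered_blocks w) \<and> gap_inside g (ordered_blocks w ! i))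
      < length (ordered_blocks w)"
    if "\<exists>i<length (ordered_blocks w). gap_inside g (ordered_blocks w ! i)"
    using LeastI_ex[OF that] by blast
  ultimately show ?thesis by (auto simp: grow_index_def)
qed

lemma grow_index_le: "grow_index w g \<le> length (ordered_blocks w)"
proof (cases "\<exists>i<length (ordered_blocks w). gap_inside g (ordered_blocks w ! i)")
  case True
  from LeastI_ex[OF True] True show ?thesis unfolding grow_index_def if_P[OF True] by simp
next
  case False
  show ?thesis unfolding grow_index_def if_not_P[OF False] by simp
qed

lemma grow_index_eq_iff:
  assumes "k_stirling k n w" "i < length (ordered_blocks w)"
  shows "grow_index w g = i \<longleftrightarrow> gap_inside g (ordered_blocks w ! i)"
proof -
  let ?P = "\<lambda>i. i < length (ordered_blocks w) \<and> gap_inside g (ordered_blocks w ! i)"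
  have uniq: "a = b" if "?P a" "?P b" for a b
  proof -
    have "ordered_blocks w ! a = ordered_blocks w ! b"
      using that nth_ordered_blocks by (intro gap_inside_unique[OF assms(1), where g = g]) auto
    then show ?thesis using that distinct_ordered_blocks by (simp add: nth_eq_iff_index_eq)
  qed
  show ?thesis
  proof (cases "Ex ?P")
    case True
    then have "grow_index w g = (LEAST i. ?P i)" by (auto simp: grow_index_def)
    then have "?P (grow_index w g)" using LeastI_ex[OF True] by simp
    then show ?thesis using uniq assms(2) by metis
  next
    case False
    then show ?thesis using assms(2) by (auto simp: grow_index_def)
  qed
qed

text \<open>Old labels are unchanged and the new label is the largest, so a new block can only be
  appended. Hence an index, once in use, denotes the same block at all later orders.\<close>

lemma ordered_blocks_insert_run:
  assumes "k_stirling k n w" "0 < k" "g \<le> length w"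
  shows "ordered_blocks (insert_run k (Suc n) g w) =
    map (map_prod (shift_pos k g) (shift_pos k g)) (ordered_blocks w) @
    (if grow_index w g < length (ordered_blocks w) then [] else [(g, g + k - 1)])" (is "_ = ?bs")
proof (rule ordered_blocks_unique)
  have lt: "\<forall>x\<in>set w. x < Suc n" using assms(1) by (auto simp: k_stirling_def)
  show "set ?bs = blocks (insert_run k (Suc n) g w)"
    unfolding blocks_insert_run[OF assms(3) lt assms(2)] grow_index_less_iff
    by (auto simp: ordered_blocks(1))
  have "map (block_label (insert_run k (Suc n) g w))
      (map (map_prod (shift_pos k g) (shift_pos k g)) (ordered_blocks w)) =
      map (block_label w) (ordered_blocks w)"
    unfolding map_map
  proof (rule map_cong[OF refl])
    fix B assume "B \<in> set (ordered_blocks w)"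
    moreover obtain p q where "B = (p, q)" by force
    ultimately show "(block_label (insert_run k (Suc n) g w) \<circ> map_prod (shift_pos k g) (shift_pos k g)) B =
        block_label w B"
      using blocksD[of p q w] assms(3)
      by (simp add: ordered_blocks(1) block_label_def nth_insert_run_shift)
  qed
  moreover have "block_label (insert_run k (Suc n) g w) (g, g + k - 1) = Suc n"
    using assms by (auto simp: block_label_def nth_insert_run)
  moreover have "block_label w B < Suc n" if "B \<in> set (ordered_blocks w)" for B
  proof -
    obtain p q where B: "B = (p, q)" by force
    with that have "p < length w" using blocksD[of p q w] by (simp add: ordered_blocks(1))
    then show ?thesis using lt by (simp add: B block_label_def)
  qed
  ultimately show "sorted_wrt (<) (map (block_label (insert_run k (Suc n) g w)) ?bs)"
    using ordered_blocks(2)[of w] by (auto simp: sorted_wrt_append simp del: map_map)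
qed

lemma block_length_shift:
  "p \<le> q \<Longrightarrow> block_length (map_prod (shift_pos k g) (shift_pos k g) (p, q)) =
    block_length (p, q) + (if gap_inside g (p, q) then k else 0)"
  by (auto simp: block_length_def gap_inside_def shift_pos_def)

text \<open>A gap beyond the end acts like the last gap, just as in \<open>insert_run\<close>. This
  lets the path identities hold for every outcome, although the random gaps lie in their range only
  almost surely.\<close>

lemma grow_index_min: "grow_index w (min g (length w)) = grow_index w g"
proof -
  have "gap_inside (min g (length w)) (ordered_blocks w ! i) \<longleftrightarrow> gap_inside g (ordered_blocks w ! i)"
    if "i < length (ordered_blocks w)" for i
  proof -
    have "ordered_blocks w ! i \<in> blocks w" using that nth_ordered_blocks by blast
    then show ?thesis
      using blocksD[of "fst (ordered_blocks w ! i)" "snd (ordered_blocks w ! i)" w]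
      by (cases "ordered_blocks w ! i") (auto simp: gap_inside_def)
  qed
  then have "i < length (ordered_blocks w) \<and> gap_inside (min g (length w)) (ordered_blocks w ! i) \<longleftrightarrow>
    i < length (ordered_blocks w) \<and> gap_inside g (ordered_blocks w ! i)" for i by blast
  then show ?thesis unfolding grow_index_def by (simp only:)
qed

lemma length_ordered_blocks_insert_run:
  assumes "k_stirling k n w" "0 < k"
  shows "length (ordered_blocks (insert_run k (Suc n) g w)) =
    max (length (ordered_blocks w)) (Suc (grow_index w g))"
  using ordered_blocks_insert_run[OF assms, of "min g (length w)"] grow_index_le[of w g]
  by (simp add: insert_run_min[symmetric] grow_index_min)

text \<open>Size 0 for a block that does not exist yet lets one formula cover both growth and
  creation, as a new block consists of the k inserted letters.\<close>

lemma block_size_insert_run: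
  assumes "k_stirling k n w" "0 < k"
  shows "block_size (insert_run k (Suc n) g w) (Suc i) =
    block_size w (Suc i) + (if grow_index w g = i then k else 0)"
proof -
  define h where "h = min g (length w)"
  have h: "h \<le> length w" "insert_run k (Suc n) g w = insert_run k (Suc n) h w"
    "grow_index w g = grow_index w h"
    by (auto simp: h_def insert_run_min[symmetric] grow_index_min)
  note ob = ordered_blocks_insert_run[OF assms h(1)]
  show ?thesis
  proof (cases "i < length (ordered_blocks w)")
    case True
    then have "ordered_blocks w ! i \<in> blocks w" using ordered_blocks(1) nth_mem by blast
    then have "block_length (map_prod (shift_pos k h) (shift_pos k h) (ordered_blocks w ! i)) =
      block_length (ordered_blocks w ! i) + (if gap_inside h (ordered_blocks w ! i) then k else 0)"
      by (cases "ordered_blocks w ! i") (simp only: block_length_shift blocksD(1))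
    then show ?thesis using True
      by (simp add: h block_size_def ob nth_append grow_index_eq_iff[OF assms(1)])
  next
    case False
    then show ?thesis using grow_index_le[of w h] assms(2)
      by (auto simp: h block_size_def ob nth_append block_length_def)
  qed
qed

lemma card_grow_index:
  assumes "k_stirling k n w" "i < length (ordered_blocks w)"
  shows "card {g \<in> {0..length w}. grow_index w g = i} = block_size w (Suc i) - 1"
proof -
  obtain p q where pq: "ordered_blocks w ! i = (p, q)" by force
  then have "(p, q) \<in> blocks w" using assms(2) nth_ordered_blocks by metis
  then have "{g \<in> {0..length w}. grow_index w g = i} = {p<..q}"
    unfolding grow_index_eq_iff[OF assms] pq by (auto simp: gap_inside_def dest: blocksD)
  then show ?thesis using assms(2) by (simp add: block_size_def pq block_length_def)
qed

section \<open>The path of growing blocks\<close>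

text \<open>
  A path \<open>c\<close> records in \<open>c t\<close> the 0-based index of the block that grows in the step from order \<open>t\<close> to
  order \<open>t + 1\<close>; a new block is opened when \<open>c t\<close> equals the current number of blocks.
\<close>

primrec num_blocks :: "(nat \<Rightarrow> nat) \<Rightarrow> nat \<Rightarrow> nat" where
  "num_blocks c 0 = 0"
| "num_blocks c (Suc t) = max (num_blocks c t) (Suc (c t))"

definition visits :: "(nat \<Rightarrow> nat) \<Rightarrow> nat \<Rightarrow> nat \<Rightarrow> nat" where
  "visits c t i = card {r. r < t \<and> c r = i}"

text \<open>The two-parameter Chinese restaurant process with discount and strength 1/k, in
  fractions cleared of 1/k. A path that skips an index gets probability 0; at t = 0 the formula
  forces block 0.\<close>

definition urn_step :: "nat \<Rightarrow> (nat \<Rightarrow> nat) \<Rightarrow> nat \<Rightarrow> real" where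
  "urn_step k c t =
     (if c t < num_blocks c t then (real k * real (visits c t (c t)) - 1) / (real k * real t + 1)
      else if c t = num_blocks c t then (real (num_blocks c t) + 1) / (real k * real t + 1) else 0)"

definition growth_path :: "nat \<Rightarrow> (nat \<Rightarrow> nat) \<Rightarrow> nat \<Rightarrow> nat" where
  "growth_path k u t = grow_index (stirling_growth k u t) (u t)"

lemma visits_0 [simp]: "visits c 0 i = 0"
  by (simp add: visits_def)

lemma visits_Suc: "visits c (Suc t) i = visits c t i + (if c t = i then 1 else 0)"
proof -
  have "{r. r < Suc t \<and> c r = i} = {r. r < t \<and> c r = i} \<union> (if c t = i then {t} else {})"
    by (auto simp: less_Suc_eq)
  then show ?thesis by (simp add: visits_def)
qed

lemma num_blocks_cong:
  "(\<And>r. r < t \<Longrightarrow> c r = d r) \<Longrightarrow> num_blocks c t = num_blocks d t"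
  by (induction t) auto

lemma visits_cong:
  "(\<And>r. r < t \<Longrightarrow> c r = d r) \<Longrightarrow> visits c t i = visits d t i"
  by (induction t) (auto simp: visits_Suc)

lemma less_num_blocks: "r < t \<Longrightarrow> c r < num_blocks c t"
  by (induction t) (auto simp: less_Suc_eq)

lemma visits_eq_0_iff: "visits c t i = 0 \<longleftrightarrow> (\<forall>r<t. c r \<noteq> i)"
  by (auto simp: visits_def)

text \<open>The path never jumps over an index, so every index below the current number of blocks
  was once the newest.\<close>

lemma visits_pos:
  assumes "\<And>r. r < t \<Longrightarrow> c r \<le> num_blocks c r" "i < num_blocks c t"
  shows "visits c t i > 0"
  using assms
proof (induction t)
  case (Suc t)
  show ?case
  proof (cases "i < num_blocks c t")
    case True
    then show ?thesis using Suc by (simp add: visits_Suc)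
  next
    case False
    then have "i = c t" using Suc.prems(1)[of t] Suc.prems(2) by auto
    then show ?thesis by (simp add: visits_Suc)
  qed
qed simp

lemma sum_visits:
  assumes "\<And>r. r < t \<Longrightarrow> c r < m"
  shows "(\<Sum>i<m. visits c t i) = t"
  using assms by (induction t) (simp_all add: visits_Suc sum.distrib)

text \<open>Order 1 also arises by insertion, into the empty word, where every gap gives the same
  result. Inductions can thus start at order 0.\<close>

lemma stirling_growth_Suc:
  "stirling_growth k u (Suc t) = insert_run k (Suc t) (u t) (stirling_growth k u t)"
  by (cases t) (simp_all add: insert_run_def)

lemma length_stirling_growth: "length (stirling_growth k u n) = k * n"
  by (induction n) (simp_all add: stirling_growth_Suc)

lemma ordered_blocks_Nil [simp]: "ordered_blocks [] = []"
proof -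
  have "set (ordered_blocks []) = {}"
    unfolding ordered_blocks(1) by (simp add: blocks_def closed_substrings_def)
  then show ?thesis by simp
qed

lemma grow_index_Nil [simp]: "grow_index [] g = 0"
  by (simp add: grow_index_def)

lemma stirling_growth_cong:
  "(\<And>m. 1 \<le> m \<Longrightarrow> m < t \<Longrightarrow> u m = v m) \<Longrightarrow> stirling_growth k u t = stirling_growth k v t"
  by (induction k u t rule: stirling_growth.induct) simp_all

lemma growth_path_cong:
  assumes "\<And>m. 1 \<le> m \<Longrightarrow> m \<le> t \<Longrightarrow> u m = v m"
  shows "growth_path k u t = growth_path k v t"
proof (cases t)
  case (Suc s)
  have "stirling_growth k u t = stirling_growth k v t" by (rule stirling_growth_cong) (simp add: assms)
  then show ?thesis using assms[of t] Suc by (simp add: growth_path_def)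
qed (simp add: growth_path_def)

section \<open>Block sizes and gap counts along the growth process\<close>

context
  fixes k :: nat assumes k: "0 < k"
begin

lemma num_blocks_growth_path:
  "num_blocks (growth_path k u) t = length (ordered_blocks (stirling_growth k u t))"
proof (induction t)
  case (Suc t)
  show ?case unfolding stirling_growth_Suc
    by (simp add: length_ordered_blocks_insert_run[OF k_stirling_growth k] Suc flip: growth_path_def)
qed simp

lemma growth_path_le_num_blocks: "growth_path k u t \<le> num_blocks (growth_path k u) t"
  unfolding num_blocks_growth_path by (simp add: growth_path_def grow_index_le)

lemma block_size_growth:
  "block_size (stirling_growth k u t) (Suc i) = k * visits (growth_path k u) t i"
proof (induction t)
  case (Suc t)
  show ?case unfolding stirling_growth_Suc
    by (simp add: block_size_insert_run[OF k_stirling_growth k] Suc visits_Suc flip: growth_path_def)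
qed (simp add: block_size_def)

text \<open>An old block with x visits has length k x and hence k x - 1 inner gaps. Since visits sum
  to t, the s blocks together contain k t - s gaps, which leaves s + 1 of the k t + 1 gaps for
  opening a new block. Only the path so far enters these counts, not the permutation itself.\<close>

lemma card_growth_path:
  assumes c: "\<And>r. r < t \<Longrightarrow> growth_path k u r = c r"
  shows "real (card ({g. grow_index (stirling_growth k u t) g = c t} \<inter> {0..k * t})) / (real k * real t + 1)
    = urn_step k c t"
proof -
  define w where "w = stirling_growth k u t"
  define s where "s = num_blocks c t"
  have s: "length (ordered_blocks w) = s"
    unfolding w_def s_def num_blocks_growth_path[symmetric] by (rule num_blocks_cong) (rule c)
  have "visits (growth_path k u) t i = visits c t i" for i by (rule visits_cong) (rule c)
  then have bs: "block_size w (Suc i) = k * visits c t i" for i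
    by (simp add: w_def block_size_growth)
  have lw: "length w = k * t" by (simp add: w_def length_stirling_growth)
  have st: "k_stirling k t w" by (simp add: w_def k_stirling_growth)
  have set_eq: "{g. grow_index w g = i} \<inter> {0..k * t} = {g \<in> {0..length w}. grow_index w g = i}" for i
    by (auto simp: lw)
  have vpos: "visits c t i > 0" if "i < s" for i
    using that unfolding s_def
  proof (rule visits_pos[rotated])
    fix r assume "r < t"
    then show "c r \<le> num_blocks c r"
      using growth_path_le_num_blocks[of u r] c num_blocks_cong[of r "growth_path k u" c] by simp
  qed
  have old: "real (card ({g. grow_index w g = i} \<inter> {0..k * t})) = real k * real (visits c t i) - 1"
    if "i < s" for i
  proof -
    have "1 \<le> k * visits c t i" using k vpos[OF that] by simp
    then show ?thesis
      unfolding set_eq using card_grow_index[OF st, of i] that by (simp add: s bs of_nat_diff)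
  qed
  have "card {0..k * t} = (\<Sum>i\<in>{..s}. card ({g. grow_index w g = i} \<inter> {0..k * t}))"
  proof -
    have "{0..k * t} = (\<Union>i\<in>{..s}. {g. grow_index w g = i} \<inter> {0..k * t})"
      using grow_index_le[of w] by (auto simp: s)
    then have "card {0..k * t} = card (\<Union>i\<in>{..s}. {g. grow_index w g = i} \<inter> {0..k * t})" by simp
    also have "\<dots> = (\<Sum>i\<in>{..s}. card ({g. grow_index w g = i} \<inter> {0..k * t}))"
      by (rule card_UN_disjoint) auto
    finally show ?thesis .
  qed
  then have "real k * real t + 1 =
      (\<Sum>i<s. real (card ({g. grow_index w g = i} \<inter> {0..k * t}))) +
      real (card ({g. grow_index w g = s} \<inter> {0..k * t}))"
    by (simp add: lessThan_Suc_atMost[symmetric] algebra_simps flip: of_nat_sum of_nat_mult of_nat_add)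
  also have "(\<Sum>i<s. real (card ({g. grow_index w g = i} \<inter> {0..k * t}))) =
      real k * real (\<Sum>i<s. visits c t i) - real s"
    by (simp add: old sum_subtractf sum_distrib_left)
  also have "(\<Sum>i<s. visits c t i) = t"
    by (rule sum_visits) (simp add: s_def less_num_blocks)
  finally have new: "real (card ({g. grow_index w g = s} \<inter> {0..k * t})) = real s + 1" by simp
  have none: "{g. grow_index w g = i} \<inter> {0..k * t} = {}" if "i > s" for i
  proof -
    have "grow_index w g \<noteq> i" for g using grow_index_le[of w g] that s by linarith
    then show ?thesis by blast
  qed
  show ?thesis
    unfolding urn_step_def w_def[symmetric] s_def[symmetric]
    using old[of "c t"] new none[of "c t"] by (cases "c t" s rule: linorder_cases) auto
qed

end

text \<open>Here X is the history and Y the next gap. The favourable set \<open>G x\<close> depends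
  on the history, but its probability is the same for all histories in A; Fubini for the product law
  then gives a product.\<close>

lemma (in prob_space) indep_var_prob_const_section:
  fixes X Y :: "'a \<Rightarrow> 'b :: countable"
  assumes "indep_var (count_space UNIV) X (count_space UNIV) Y"
    and p: "\<And>x. x \<in> A \<Longrightarrow> prob {\<omega> \<in> space M. Y \<omega> \<in> G x} = p"
  shows "prob {\<omega> \<in> space M. X \<omega> \<in> A \<and> Y \<omega> \<in> G (X \<omega>)} = prob {\<omega> \<in> space M. X \<omega> \<in> A} * p"
proof (cases "A = {}")
  case False
  then obtain a where "a \<in> A" by auto
  then have p0: "p \<ge> 0" using p[of a] by auto
  let ?C = "count_space UNIV :: 'b measure"
  have rv [measurable]: "X \<in> measurable M ?C" "Y \<in> measurable M ?C"
    using indep_var_rv1[OF assms(1)] indep_var_rv2[OF assms(1)] by auto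
  have eq: "distr M ?C X \<Otimes>\<^sub>M distr M ?C Y = distr M (?C \<Otimes>\<^sub>M ?C) (\<lambda>\<omega>. (X \<omega>, Y \<omega>))"
    using assms(1) by (simp add: indep_var_distribution_eq)
  interpret Y: prob_space "distr M ?C Y" by (rule prob_space_distr) fact
  let ?S = "{(x, y). x \<in> A \<and> y \<in> G x}"
  have S: "?S \<in> sets (?C \<Otimes>\<^sub>M ?C)"
    by (subst pair_measure_countable) simp_all
  have "emeasure M {\<omega> \<in> space M. X \<omega> \<in> A \<and> Y \<omega> \<in> G (X \<omega>)} =
      emeasure (distr M (?C \<Otimes>\<^sub>M ?C) (\<lambda>\<omega>. (X \<omega>, Y \<omega>))) ?S"
    using S by (subst emeasure_distr) (auto intro!: arg_cong[where f = "emeasure M"])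
  also have "\<dots> = emeasure (distr M ?C X \<Otimes>\<^sub>M distr M ?C Y) ?S" by (simp add: eq)
  also have "\<dots> = (\<integral>\<^sup>+x. emeasure (distr M ?C Y) (Pair x -` ?S) \<partial>distr M ?C X)"
  proof (rule Y.emeasure_pair_measure_alt)
    have "sets (distr M ?C X \<Otimes>\<^sub>M distr M ?C Y) = sets (?C \<Otimes>\<^sub>M ?C)"
      by (rule sets_pair_measure_cong) simp_all
    then show "?S \<in> sets (distr M ?C X \<Otimes>\<^sub>M distr M ?C Y)" using S by (simp only:)
  qed
  also have "\<dots> = (\<integral>\<^sup>+x. ennreal p * indicator A x \<partial>distr M ?C X)"
  proof (rule nn_integral_cong)
    fix x
    show "emeasure (distr M ?C Y) (Pair x -` ?S) = ennreal p * indicator A x"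
    proof (cases "x \<in> A")
      case True
      have "emeasure (distr M ?C Y) (Pair x -` ?S) = emeasure M {\<omega> \<in> space M. Y \<omega> \<in> G x}"
        using True by (subst emeasure_distr) (auto intro!: arg_cong[where f = "emeasure M"])
      then show ?thesis using True p by (simp add: emeasure_eq_measure)
    qed auto
  qed
  also have "\<dots> = ennreal p * emeasure (distr M ?C X) A"
    by (simp add: nn_integral_cmult_indicator)
  also have "emeasure (distr M ?C X) A = emeasure M {\<omega> \<in> space M. X \<omega> \<in> A}"
    by (subst emeasure_distr) (auto intro!: arg_cong[where f = "emeasure M"])
  finally show ?thesis
    using p0 by (simp add: emeasure_eq_measure mult.commute flip: ennreal_mult)
qed simp

text \<open>Finite histories are encoded as lists: these form a countable type, so preimages of
  single lists suffice.\<close>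

lemma measurable_map_PiM_count_space:
  fixes xs :: "'i list"
  assumes "set xs \<subseteq> I"
  shows "(\<lambda>h. map h xs) \<in> measurable (PiM I (\<lambda>_. count_space UNIV)) (count_space (UNIV :: 'b :: countable list set))"
proof -
  let ?P = "PiM I (\<lambda>_. count_space UNIV) :: ('i \<Rightarrow> 'b) measure"
  have "(\<lambda>h. map h xs) -` {l} \<inter> space ?P \<in> sets ?P" for l :: "'b list"
  proof -
    have m: "(\<lambda>h. h (xs ! i)) \<in> measurable ?P (count_space UNIV)" if "i < length xs" for i
      using assms that by (intro measurable_component_singleton) auto
    have "{h \<in> space ?P. length l = length xs \<and> (\<forall>i\<in>{..<length xs}. h (xs ! i) = l ! i)} \<in> sets ?P"
      (is "?S \<in> _")
    proof (intro sets.sets_Collect sets.sets_Collect_finite_All)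
      fix i assume "i \<in> {..<length xs}"
      then have "(\<lambda>h. h (xs ! i)) -` {l ! i} \<inter> space ?P \<in> sets ?P"
        by (intro measurable_sets[OF m]) auto
      also have "(\<lambda>h. h (xs ! i)) -` {l ! i} \<inter> space ?P = {h \<in> space ?P. h (xs ! i) = l ! i}" by auto
      finally show "{h \<in> space ?P. h (xs ! i) = l ! i} \<in> sets ?P" .
    qed auto
    also have "?S = (\<lambda>h. map h xs) -` {l} \<inter> space ?P"
      by (auto simp: list_eq_iff_nth_eq)
    finally show ?thesis .
  qed
  then show ?thesis by (simp add: measurable_count_space_eq2_countable)
qed

section \<open>Prefix probabilities of the growth path\<close>

locale stirling_process = prob_space M for M :: "'a measure" +
  fixes k :: nat and U :: "nat \<Rightarrow> 'a \<Rightarrow> nat"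
  assumes k_ge_2: "k \<ge> 2"
    and indep_U: "indep_vars (\<lambda>_. count_space UNIV) U {1..}"
    and distr_U: "\<And>n. n \<ge> 1 \<Longrightarrow>
      distr M (count_space UNIV) (U n) = measure_pmf (pmf_of_set {0..k * n})"
begin

definition block_path :: "'a \<Rightarrow> nat \<Rightarrow> nat" where
  "block_path \<omega> = growth_path k (\<lambda>m. U m \<omega>)"

lemma measurable_U: "n \<ge> 1 \<Longrightarrow> U n \<in> measurable M (count_space UNIV)"
  using indep_U by (auto simp: indep_vars_def)

lemma prob_U:
  assumes "n \<ge> 1"
  shows "prob {\<omega> \<in> space M. U n \<omega> \<in> G} = real (card (G \<inter> {0..k * n})) / (real k * real n + 1)"
proof -
  have "prob {\<omega> \<in> space M. U n \<omega> \<in> G} = measure (distr M (count_space UNIV) (U n)) G"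
    using measurable_U[OF assms]
    by (subst measure_distr) (auto intro!: arg_cong[where f = "measure M"])
  also have "\<dots> = real (card (G \<inter> {0..k * n})) / (real k * real n + 1)"
    by (simp add: distr_U[OF assms] measure_pmf_of_set Int_commute)
  finally show ?thesis .
qed

text \<open>Reads a list as the gaps chosen at orders 1, 2, ...; list positions start at 0, orders
  at 1.\<close>

definition unlist :: "nat list \<Rightarrow> nat \<Rightarrow> nat" where
  "unlist l m = l ! (m - 1)"

lemma unlist_map_upt: "1 \<le> m \<Longrightarrow> m < n \<Longrightarrow> unlist (map f [1..<n]) m = f m"
  by (cases m) (simp_all add: unlist_def del: upt_Suc)

lemma path_unlist:
  assumes "t < n"
  shows "block_path \<omega> t = growth_path k (unlist (map (\<lambda>m. U m \<omega>) [1..<n])) t"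
  unfolding block_path_def by (rule growth_path_cong) (use assms in \<open>simp add: unlist_map_upt del: One_nat_def\<close>)

text \<open>The next gap is independent of the list of earlier gaps, and by
  \<open>card_growth_path\<close> its chance to continue the path as c prescribes is the same for
  all lists that have produced c so far.\<close>

lemma prob_path_prefix:
  "prob {\<omega> \<in> space M. \<forall>t<n. block_path \<omega> t = c t} = (\<Prod>t<n. urn_step k c t)"
proof (induction n)
  case 0
  then show ?case by (simp add: prob_space)
next
  case (Suc n)
  have k0: "0 < k" using k_ge_2 by simp
  show ?case
  proof (cases "n = 0")
    \<comment> \<open>The gap laws start at order 1. The step from order 0 surely opens block 0, in
      agreement with \<open>urn_step\<close>.\<close>
    case True
    have "block_path \<omega> 0 = 0" for \<omega> by (simp add: block_path_def growth_path_def)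
    then show ?thesis using True by (simp add: urn_step_def prob_space)
  next
    case False
    define X where "X = (\<lambda>\<omega>. map (\<lambda>m. U m \<omega>) [1..<n])"
    define A where "A = {l. \<forall>t<n. growth_path k (unlist l) t = c t}"
    \<comment> \<open>The next gap is wrapped in a one-element list to give it the same type as the
      history X, which \<open>indep_var\<close> requires.\<close>
    define G where "G l = (\<lambda>g. [g]) ` {g. grow_index (stirling_growth k (unlist l) n) g = c n}" for l
    have X_A: "X \<omega> \<in> A \<longleftrightarrow> (\<forall>t<n. block_path \<omega> t = c t)" for \<omega>
      by (auto simp: X_def A_def path_unlist)
    have "stirling_growth k (\<lambda>m. U m \<omega>) n = stirling_growth k (unlist (X \<omega>)) n" for \<omega>
      by (rule stirling_growth_cong) (simp add: unlist_map_upt X_def del: One_nat_def)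
    then have X_G: "[U n \<omega>] \<in> G (X \<omega>) \<longleftrightarrow> block_path \<omega> n = c n" for \<omega>
      by (auto simp: G_def block_path_def growth_path_def)
    have "indep_var (PiM {1..<n} (\<lambda>_. count_space UNIV)) (\<lambda>\<omega>. restrict (\<lambda>i. U i \<omega>) {1..<n})
        (PiM {n} (\<lambda>_. count_space UNIV)) (\<lambda>\<omega>. restrict (\<lambda>i. U i \<omega>) {n})"
      by (rule indep_var_restrict[OF indep_U]) (use False in auto)
    then have "indep_var (count_space UNIV) ((\<lambda>h. map h [1..<n]) \<circ> (\<lambda>\<omega>. restrict (\<lambda>i. U i \<omega>) {1..<n}))
        (count_space UNIV) ((\<lambda>h. map h [n]) \<circ> (\<lambda>\<omega>. restrict (\<lambda>i. U i \<omega>) {n}))"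
      by (rule indep_var_compose) (auto simp del: list.map intro: measurable_map_PiM_count_space)
    also have "(\<lambda>h. map h [1..<n]) \<circ> (\<lambda>\<omega>. restrict (\<lambda>i. U i \<omega>) {1..<n}) = X"
      by (auto simp: X_def fun_eq_iff)
    also have "(\<lambda>h. map h [n]) \<circ> (\<lambda>\<omega>. restrict (\<lambda>i. U i \<omega>) {n}) = (\<lambda>\<omega>. [U n \<omega>])"
      by (auto simp: fun_eq_iff)
    finally have "indep_var (count_space UNIV) X (count_space UNIV) (\<lambda>\<omega>. [U n \<omega>])" .
    then have "prob {\<omega> \<in> space M. X \<omega> \<in> A \<and> [U n \<omega>] \<in> G (X \<omega>)} =
        prob {\<omega> \<in> space M. X \<omega> \<in> A} * urn_step k c n"
    proof (rule indep_var_prob_const_section)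
      fix l assume "l \<in> A"
      then show "prob {\<omega> \<in> space M. [U n \<omega>] \<in> G l} = urn_step k c n"
        using False card_growth_path[OF k0, of n "unlist l" c]
          prob_U[of n "{g. grow_index (stirling_growth k (unlist l) n) g = c n}"]
        by (simp add: G_def A_def inj_image_mem_iff[of "\<lambda>g. [g]"] inj_def)
    qed
    also have "{\<omega> \<in> space M. X \<omega> \<in> A \<and> [U n \<omega>] \<in> G (X \<omega>)} = {\<omega> \<in> space M. \<forall>t<Suc n. block_path \<omega> t = c t}"
      by (auto simp: X_A X_G less_Suc_eq)
    also have "{\<omega> \<in> space M. X \<omega> \<in> A} = {\<omega> \<in> space M. \<forall>t<n. block_path \<omega> t = c t}"
      by (simp add: X_A)
    finally show ?thesis using Suc by simp
  qed
qed

lemma measurable_path: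
  "block_path \<in> measurable M (PiM UNIV (\<lambda>_. count_space UNIV))"
proof (rule measurable_PiM_single')
  fix t :: nat
  let ?f = "\<lambda>l. growth_path k (unlist l) t"
  have "(\<lambda>\<omega>. map (\<lambda>m. U m \<omega>) [1..<Suc t]) \<in> measurable M (count_space UNIV)"
  proof -
    have "(\<lambda>\<omega>. \<lambda>i\<in>{1..<Suc t}. U i \<omega>) \<in> measurable M (PiM {1..<Suc t} (\<lambda>_. count_space UNIV))"
      by (rule measurable_restrict) (simp add: measurable_U)
    moreover have "set [1..<Suc t] \<subseteq> {1..<Suc t}" by auto
    ultimately have "(\<lambda>\<omega>. map (\<lambda>i\<in>{1..<Suc t}. U i \<omega>) [1..<Suc t]) \<in> measurable M (count_space UNIV)"
      by (rule measurable_compose[OF _ measurable_map_PiM_count_space])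
    moreover have "map (\<lambda>i\<in>{1..<Suc t}. U i \<omega>) [1..<Suc t] = map (\<lambda>m. U m \<omega>) [1..<Suc t]" for \<omega>
      by (simp del: upt_Suc)
    ultimately show ?thesis by (simp only:)
  qed
  from measurable_compose[OF this, of ?f "count_space UNIV"]
  show "(\<lambda>\<omega>. block_path \<omega> t) \<in> measurable M (count_space UNIV)"
    by (simp add: path_unlist[of t "Suc t"] del: upt_Suc)
qed auto

end

section \<open>Beta moments and the product formula\<close>

lemma Beta_pos: "0 < a \<Longrightarrow> 0 < b \<Longrightarrow> 0 < Beta a (b :: real)"
  by (simp add: Beta_altdef rGamma_inverse_Gamma Gamma_real_pos)

definition beta_measure :: "real \<Rightarrow> real \<Rightarrow> real measure" where
  "beta_measure a b = density lborel (\<lambda>x. ennreal (beta_density a b x))"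

text \<open>The expectation of \<open>x ^ i * (1 - x) ^ j\<close> under Beta(a, b); see
  \<open>nn_integral_beta_measure\<close>.\<close>

definition beta_moment :: "real \<Rightarrow> real \<Rightarrow> nat \<Rightarrow> nat \<Rightarrow> real" where
  "beta_moment a b i j = Beta (a + real i) (b + real j) / Beta a b"

lemma space_beta_measure [simp]: "space (beta_measure a b) = UNIV"
  by (simp add: beta_measure_def)

lemma sets_beta_measure [simp, measurable_cong]: "sets (beta_measure a b) = sets borel"
  by (simp add: beta_measure_def)

lemma borel_measurable_beta_density [measurable]: "beta_density a b \<in> borel_measurable borel"
  unfolding beta_density_def by measurable

lemma beta_moment_0_0: "0 < a \<Longrightarrow> 0 < b \<Longrightarrow> beta_moment a b 0 0 = 1"
  using Beta_pos[of a b] by (simp add: beta_moment_def)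

lemma beta_moment_Suc_left:
  assumes "0 < a" "0 < b"
  shows "beta_moment a b (Suc i) j = beta_moment a b i j * ((a + real i) / (a + b + real i + real j))"
proof -
  have "a + real i \<notin> \<int>\<^sub>\<le>\<^sub>0" using assms by (auto elim!: nonpos_Ints_cases)
  from Beta_plus1_left[OF this, of "b + real j"] assms
  have "Beta (a + real i + 1) (b + real j) = Beta (a + real i) (b + real j) * ((a + real i) / (a + b + real i + real j))"
    by (simp add: field_simps)
  then show ?thesis by (simp add: beta_moment_def algebra_simps)
qed

lemma beta_moment_Suc_right:
  assumes "0 < a" "0 < b"
  shows "beta_moment a b i (Suc j) = beta_moment a b i j * ((b + real j) / (a + b + real i + real j))"
proof -
  have "b + real j \<notin> \<int>\<^sub>\<le>\<^sub>0" using assms by (auto elim!: nonpos_Ints_cases)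
  from Beta_plus1_right[OF this, of "a + real i"] assms
  have "Beta (a + real i) (b + real j + 1) = Beta (a + real i) (b + real j) * ((b + real j) / (a + b + real i + real j))"
    by (simp add: field_simps)
  then show ?thesis by (simp add: beta_moment_def algebra_simps)
qed

text \<open>Multiplication by the integrand turns the density into that of Beta(a + i, b + j) up to
  the normalising constant.\<close>

lemma nn_integral_beta_measure:
  assumes "0 < a" "0 < b"
  shows "(\<integral>\<^sup>+x. ennreal (x ^ i * (1 - x) ^ j) \<partial>beta_measure a b) = ennreal (beta_moment a b i j)"
proof -
  have B: "0 < Beta a b" by (rule Beta_pos[OF assms])
  let ?f = "\<lambda>t::real. t powr (a + real i - 1) * (1 - t) powr (b + real j - 1)"
  have "(\<integral>\<^sup>+x. ennreal (x ^ i * (1 - x) ^ j) \<partial>beta_measure a b) =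
      (\<integral>\<^sup>+x. ennreal (beta_density a b x) * ennreal (x ^ i * (1 - x) ^ j) \<partial>lborel)"
    unfolding beta_measure_def by (subst nn_integral_density) auto
  also have "\<dots> = (\<integral>\<^sup>+x. ennreal (indicator {0..1} x * (?f x / Beta a b)) \<partial>lborel)"
  proof (rule nn_integral_cong_AE)
    have "AE x in lborel. x \<noteq> (0::real)" "AE x in lborel. x \<noteq> (1::real)"
      by (rule AE_lborel_singleton)+
    then show "AE x in lborel. ennreal (beta_density a b x) * ennreal (x ^ i * (1 - x) ^ j) =
        ennreal (indicator {0..1} x * (?f x / Beta a b))"
    proof eventually_elim
      case (elim x)
      show ?case
      proof (cases "0 < x \<and> x < 1")
        case True
        have "x powr (a + real i - 1) = x powr (a - 1) * x ^ i"
          using True by (simp add: powr_realpow[symmetric] powr_add[symmetric] algebra_simps)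
        moreover have "(1 - x) powr (b + real j - 1) = (1 - x) powr (b - 1) * (1 - x) ^ j"
          using True by (simp add: powr_realpow[symmetric] powr_add[symmetric] algebra_simps)
        ultimately show ?thesis using True B
          by (simp add: beta_density_def ennreal_mult'[symmetric] mult_ac)
      qed (use elim in \<open>auto simp: beta_density_def indicator_def\<close>)
    qed
  qed
  also have "\<dots> = ennreal (beta_moment a b i j)"
  proof -
    have "((\<lambda>t. ?f t / Beta a b) has_integral Beta (a + real i) (b + real j) / Beta a b) {0..1}"
      by (intro has_integral_divide has_integral_Beta_real) (use assms in auto)
    from nn_integral_has_integral_lebesgue[OF _ this] show ?thesis
      using B by (simp add: beta_moment_def)
  qed
  finally show ?thesis .
qed

lemma prob_space_beta_measure: "0 < a \<Longrightarrow> 0 < b \<Longrightarrow> prob_space (beta_measure a b)"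
  using nn_integral_beta_measure[of a b 0 0] by (intro prob_spaceI) (simp add: beta_moment_0_0)

lemma AE_beta_measure: "AE x in beta_measure a b. 0 < x \<and> x < 1"
  unfolding beta_measure_def by (subst AE_density) (auto simp: beta_density_def)

section \<open>Independence and integrals on product measures\<close>

lemma indep_vars_PiM_components:
  assumes "I \<noteq> {}" "\<And>i. i \<in> I \<Longrightarrow> prob_space (M i)"
  shows "prob_space.indep_vars (PiM I M) M (\<lambda>i \<omega>. \<omega> i) I"
proof -
  interpret prob_space "PiM I M" using assms(2) by (rule prob_space_PiM)
  have "distr (PiM I M) (PiM I M) (\<lambda>x. \<lambda>i\<in>I. x i) = distr (PiM I M) (PiM I M) (\<lambda>x. x)"
    by (rule distr_cong) (auto simp: space_PiM PiE_def extensional_restrict)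
  also have "\<dots> = PiM I M" by (rule distr_id)
  also have "\<dots> = (\<Pi>\<^sub>M i\<in>I. distr (PiM I M) (M i) (\<lambda>\<omega>. \<omega> i))"
    by (rule PiM_cong) (simp_all add: distr_PiM_component assms)
  finally show ?thesis using assms(1) by (subst indep_vars_iff_distr_eq_PiM') auto
qed

lemma nn_integral_PiM_prod:
  fixes f :: "'i \<Rightarrow> 'b \<Rightarrow> ennreal"
  assumes I: "I \<noteq> {}" and M: "\<And>i. i \<in> I \<Longrightarrow> prob_space (M i)" and J: "finite J" "J \<subseteq> I"
    and f: "\<And>i. i \<in> J \<Longrightarrow> f i \<in> borel_measurable (M i)"
  shows "(\<integral>\<^sup>+\<omega>. (\<Prod>i\<in>J. f i (\<omega> i)) \<partial>PiM I M) = (\<Prod>i\<in>J. \<integral>\<^sup>+x. f i x \<partial>M i)"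
proof -
  interpret prob_space "PiM I M" using M by (rule prob_space_PiM)
  have "indep_vars (\<lambda>_. borel) (\<lambda>i \<omega>. f i (\<omega> i)) J"
    using indep_vars_subset[OF indep_vars_PiM_components[OF I M] J(2)] f
    by (rule indep_vars_compose2)
  then have "(\<integral>\<^sup>+\<omega>. (\<Prod>i\<in>J. f i (\<omega> i)) \<partial>PiM I M) = (\<Prod>i\<in>J. \<integral>\<^sup>+\<omega>. f i (\<omega> i) \<partial>PiM I M)"
    by (intro indep_vars_nn_integral J) auto
  also have "\<dots> = (\<Prod>i\<in>J. \<integral>\<^sup>+x. f i x \<partial>M i)"
  proof (rule prod.cong[OF refl])
    fix i assume i: "i \<in> J"
    then have "i \<in> I" using J by auto
    then have "(\<integral>\<^sup>+x. f i x \<partial>M i) = (\<integral>\<^sup>+x. f i x \<partial>distr (PiM I M) (M i) (\<lambda>\<omega>. \<omega> i))"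
      by (simp add: distr_PiM_component M)
    also have "\<dots> = (\<integral>\<^sup>+\<omega>. f i (\<omega> i) \<partial>PiM I M)"
      using i \<open>i \<in> I\<close> f by (intro nn_integral_distr) auto
    finally show "(\<integral>\<^sup>+\<omega>. f i (\<omega> i) \<partial>PiM I M) = (\<integral>\<^sup>+x. f i x \<partial>M i)" ..
  qed
  finally show ?thesis .
qed

section \<open>Probability of a prefix for fixed sticks\<close>

definition remaining :: "(nat \<Rightarrow> real) \<Rightarrow> nat \<Rightarrow> real" where
  "remaining v i = (\<Prod>j<i. 1 - v j)"

definition later_visits :: "(nat \<Rightarrow> nat) \<Rightarrow> nat \<Rightarrow> nat \<Rightarrow> nat" where
  "later_visits c t i = card {r. r < t \<and> i < c r}"

text \<open>The conditional probability of a step given the sticks. A stick in use is hit with its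
  length; a new block is opened by any point in the whole remaining interval, hence no factor
  \<open>v (c t)\<close> in that case.\<close>

definition stick_step :: "(nat \<Rightarrow> real) \<Rightarrow> (nat \<Rightarrow> nat) \<Rightarrow> nat \<Rightarrow> real" where
  "stick_step v c t =
     (if c t < num_blocks c t then remaining v (c t) * v (c t)
      else if c t = num_blocks c t then remaining v (c t) else 0)"

lemma later_visits_0 [simp]: "later_visits c 0 i = 0"
  by (simp add: later_visits_def)

lemma later_visits_Suc: "later_visits c (Suc t) i = later_visits c t i + (if i < c t then 1 else 0)"
proof -
  have "{r. r < Suc t \<and> i < c r} = {r. r < t \<and> i < c r} \<union> (if i < c t then {t} else {})"
    by (auto simp: less_Suc_eq)
  then show ?thesis by (simp add: later_visits_def)
qed

text \<open>Natural subtraction gives exponent 0 both for an unvisited block and for one visited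
  once, so opening a block leaves the exponent unchanged.\<close>

lemma visits_pred_Suc:
  assumes "\<And>r. r < Suc t \<Longrightarrow> c r \<le> num_blocks c r"
  shows "visits c (Suc t) i - 1 = visits c t i - 1 + (if i = c t \<and> c t < num_blocks c t then 1 else 0)"
proof (cases "i = c t")
  case i: True
  show ?thesis
  proof (cases "c t < num_blocks c t")
    case True
    then have "visits c t i > 0" using assms i by (intro visits_pos) auto
    then show ?thesis using True i by (simp add: visits_Suc)
  next
    case False
    then have "visits c t i = 0"
      using i less_num_blocks[of _ t c] by (fastforce simp: visits_eq_0_iff)
    then show ?thesis using False i by (simp add: visits_Suc)
  qed
qed (simp add: visits_Suc)

text \<open>Spreads the probability of one step over all sticks, so that the factors of several
  steps can be collected stick by stick.\<close>

lemma prod_remaining: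
  assumes "x < L"
  shows "(\<Prod>i<L. if i = x \<and> P then v i else if i < x then 1 - v i else 1) =
    remaining v x * (if P then v x else (1 :: real))"
proof -
  let ?g = "\<lambda>i. if i = x \<and> P then v i else if i < x then 1 - v i else 1"
  have "(\<Prod>i<L. ?g i) = (\<Prod>i<Suc x. ?g i)"
    by (rule prod.mono_neutral_right) (use assms in auto)
  also have "(\<Prod>i<Suc x. ?g i) = (\<Prod>i<x. 1 - v i) * (if P then v x else 1)"
    by (auto intro!: prod.cong)
  finally show ?thesis by (simp add: remaining_def)
qed

text \<open>The product over time is regrouped by stick: a step to block x contributes 1 -
  \<open>v i\<close> for every i < x, and \<open>v x\<close> if the block is old. Sticks not yet in
  use have both exponents 0, so one bound L serves throughout the induction.\<close>

lemma prod_stick_step: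
  assumes "\<And>r. r < n \<Longrightarrow> c r \<le> num_blocks c r" "num_blocks c n \<le> L"
  shows "(\<Prod>t<n. stick_step v c t) = (\<Prod>i<L. v i ^ (visits c n i - 1) * (1 - v i) ^ later_visits c n i)"
  using assms
proof (induction n)
  case (Suc n)
  let ?f = "\<lambda>n i. v i ^ (visits c n i - 1) * (1 - v i) ^ later_visits c n i"
  let ?P = "c n < num_blocks c n"
  have "(\<Prod>i<L. ?f (Suc n) i) =
      (\<Prod>i<L. ?f n i * (if i = c n \<and> ?P then v i else if i < c n then 1 - v i else 1))"
    by (rule prod.cong[OF refl], subst visits_pred_Suc) (auto simp: later_visits_Suc intro: Suc.prems)
  also have "\<dots> = (\<Prod>i<L. ?f n i) * (remaining v (c n) * (if ?P then v (c n) else 1))"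
    using Suc.prems(2) by (subst prod.distrib, subst prod_remaining) auto
  also have "remaining v (c n) * (if ?P then v (c n) else 1) = stick_step v c n"
    using Suc.prems(1)[of n] by (auto simp: stick_step_def)
  finally show ?case using Suc by simp
qed simp

lemma visits_add_later:
  "card {r. r < n \<and> i \<le> c r} = visits c n i + later_visits c n i"
proof -
  have "{r. r < n \<and> i \<le> c r} = {r. r < n \<and> c r = i} \<union> {r. r < n \<and> i < c r}" by auto
  moreover have "card ({r. r < n \<and> c r = i} \<union> {r. r < n \<and> i < c r}) = visits c n i + later_visits c n i"
    unfolding visits_def later_visits_def by (rule card_Un_disjoint) auto
  ultimately show ?thesis by simp
qed

text \<open>With discount and strength 1/k, these are 1 - 1/k and 1/k + (i + 1)/k. Index i is
  0-based and corresponds to m = i + 1 in the theorem.\<close>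

definition stick_a :: "nat \<Rightarrow> real" where
  "stick_a k = (real k - 1) / real k"

definition stick_b :: "nat \<Rightarrow> nat \<Rightarrow> real" where
  "stick_b k i = (real i + 2) / real k"

lemma stick_ab_pos:
  assumes "k \<ge> 2"
  shows "0 < stick_a k" "0 < stick_b k i"
  using assms by (auto simp: stick_a_def stick_b_def)

text \<open>
  Each of the ratios of Beta moments for \<open>i < c n\<close> is a quotient \<open>D (i + 1) / D i\<close>, so that their
  product telescopes.
\<close>

lemma prod_beta_moment:
  assumes k: "k \<ge> 2"
    and "\<And>r. r < n \<Longrightarrow> c r \<le> num_blocks c r" "num_blocks c n \<le> L"
  shows "(\<Prod>i<L. beta_moment (stick_a k) (stick_b k i) (visits c n i - 1) (later_visits c n i)) =
    (\<Prod>t<n. urn_step k c t)"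
  using assms(2,3)
proof (induction n)
  case 0
  then show ?case using stick_ab_pos[OF k] by (simp add: beta_moment_0_0)
next
  case (Suc n)
  define x s where "x = c n" and "s = num_blocks c n"
  define p q where "p i = visits c n i - 1" and "q i = later_visits c n i" for i
  define a b where "a = stick_a k" and "b i = stick_b k i" for i
  \<comment> \<open>\<open>D i\<close> is the parameter sum of the Beta law of stick i updated by
    the first n steps. Indeed \<open>a + b i\<close> is 1 + (i + 1)/k, and the 1 makes up for the
    first visit left out of \<open>p i\<close>. The updated second parameter of stick i is
    \<open>D (Suc i)\<close>.\<close>
  define D where "D i = (real i + 1) / real k + real (card {r. r < n \<and> i \<le> c r})" for i
  note pos = stick_ab_pos[OF k, folded a_def, folded b_def]
  have xs: "x \<le> s" and xL: "x < L" using Suc.prems by (auto simp: x_def s_def)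
  have valid: "r < n \<Longrightarrow> c r \<le> num_blocks c r" for r using Suc.prems by simp
  have k0: "real k > 0" using k by simp
  have Dpos: "D i > 0" for i using k0 by (simp add: D_def add_pos_nonneg)
  have D_eq: "a + b i + real (p i) + real (q i) = D i" if "i < s" for i
  proof -
    have "visits c n i > 0" using that valid unfolding s_def by (intro visits_pos)
    then have "real (visits c n i) = real (p i) + 1" by (simp add: p_def of_nat_diff)
    then show ?thesis using k0
      by (simp add: D_def a_def b_def stick_a_def stick_b_def q_def visits_add_later field_simps)
  qed
  have D_Suc: "b i + real (q i) = D (Suc i)" for i
    by (simp add: D_def b_def stick_b_def q_def later_visits_def Suc_le_eq)
  define h where "h i = (if i = x \<and> x < s then (a + real (p i)) / (a + b i + real (p i) + real (q i))
    else if i < x then (b i + real (q i)) / (a + b i + real (p i) + real (q i)) else 1)" for i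
  have "(\<Prod>i<L. beta_moment a (b i) (visits c (Suc n) i - 1) (later_visits c (Suc n) i)) =
      (\<Prod>i<L. beta_moment a (b i) (p i) (q i) * h i)"
  proof (rule prod.cong[OF refl])
    fix i
    have 1: "visits c (Suc n) i - 1 = p i + (if i = x \<and> x < s then 1 else 0)"
      unfolding p_def x_def s_def by (rule visits_pred_Suc) (rule Suc.prems)
    have 2: "later_visits c (Suc n) i = q i + (if i < x then 1 else 0)"
      by (simp add: q_def x_def later_visits_Suc)
    show "beta_moment a (b i) (visits c (Suc n) i - 1) (later_visits c (Suc n) i) =
        beta_moment a (b i) (p i) (q i) * h i"
      unfolding 1 2 h_def
      using beta_moment_Suc_left[OF pos, of i "p i" "q i"] beta_moment_Suc_right[OF pos, of i "p i" "q i"]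
      by auto
  qed
  also have "\<dots> = (\<Prod>t<n. urn_step k c t) * (\<Prod>i<L. h i)"
    using Suc by (simp add: prod.distrib a_def b_def p_def q_def)
  also have "(\<Prod>i<L. h i) = (\<Prod>i<Suc x. h i)"
    by (rule prod.mono_neutral_right) (use xL in \<open>auto simp: h_def\<close>)
  also have "\<dots> = (\<Prod>i<x. D (Suc i) / D i) * h x"
    using xs by (simp, intro disjI2 prod.cong) (auto simp: h_def D_Suc D_eq)
  also have "(\<Prod>i<x. D (Suc i) / D i) = D x / D 0"
    using Dpos[THEN less_imp_neq] by (induction x) (auto simp: field_simps)
  \<comment> \<open>\<open>D 0\<close> is n + 1/k, the total weight of the urn. For an old block
    \<open>h x\<close> replaces \<open>D x\<close> by the updated first parameter, which is the
    number of visits minus 1/k; for a new block \<open>D s\<close> itself is (s + 1)/k.\<close>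
  also have "D x / D 0 * h x = urn_step k c n"
  proof (cases "x < s")
    case True
    have "visits c n x > 0" using True valid unfolding s_def by (intro visits_pos)
    then have px: "real (p x) = real (visits c n x) - 1" by (simp add: p_def of_nat_diff)
    have D0: "D 0 = (real k * real n + 1) / real k" using k0 by (simp add: D_def field_simps)
    have "h x = (a + real (p x)) / D x" using True D_eq by (simp add: h_def)
    then have "D x / D 0 * h x = (a + real (p x)) / D 0" using Dpos[of x] by simp
    also have "a + real (p x) = (real k * real (visits c n x) - 1) / real k"
      using k0 by (simp add: px a_def stick_a_def field_simps)
    finally show ?thesis using True k0 by (simp add: D0 urn_step_def x_def s_def)
  next
    case False
    then have x: "x = s" using xs by simp
    have "{r. r < n \<and> s \<le> c r} = {}" using less_num_blocks[of _ n c] by (fastforce simp: s_def)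
    then have "D s = (real s + 1) / real k" by (simp add: D_def)
    moreover have "D 0 = (real k * real n + 1) / real k" using k0 by (simp add: D_def field_simps)
    ultimately show ?thesis using x k0 by (simp add: h_def urn_step_def x_def[symmetric] s_def[symmetric])
  qed
  finally show ?case by (simp add: a_def b_def)
qed

section \<open>The stick-breaking model\<close>

text \<open>The strong law for indicators: Hoeffding's inequality bounds the deviations by a
  geometric sequence, and Borel-Cantelli is applied to the countably many tolerances 1/(m +
  1).\<close>

lemma AE_frequency_tendsto:
  assumes "prob_space P" and A: "A \<in> sets P"
  shows "AE y in PiM UNIV (\<lambda>_::nat. P).
    (\<lambda>n. real (card {t. t < n \<and> y t \<in> A}) / real n) \<longlonglongrightarrow> measure P A"
proof -
  interpret P: prob_space P by fact
  let ?N = "PiM UNIV (\<lambda>_::nat. P)"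
  interpret N: prob_space ?N by (intro prob_space_PiM assms)
  let ?X = "\<lambda>t y. indicator A (y t) :: real"
  define F where "F n y = (\<Sum>t<n. ?X t y) / real n" for n :: nat and y
  have F: "F n y = real (card {t. t < n \<and> y t \<in> A}) / real n" for n y
  proof -
    have "(\<Sum>t<n. ?X t y) = real (card ({..<n} \<inter> {t. y t \<in> A}))"
      by (simp add: indicator_def flip: sum.inter_filter)
    also have "{..<n} \<inter> {t. y t \<in> A} = {t. t < n \<and> y t \<in> A}" by auto
    finally show ?thesis by (simp add: F_def)
  qed
  have X [measurable]: "?X t \<in> borel_measurable ?N" for t
    using A by measurable
  have [measurable]: "F n \<in> borel_measurable ?N" for n
    unfolding F_def by measurable
  have distr_X: "distr ?N borel (?X t) = distr P borel (indicator A)" for t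
  proof -
    have "distr P borel (indicator A :: _ \<Rightarrow> real) = distr (distr ?N P (\<lambda>y. y t)) borel (indicator A)"
      by (subst distr_PiM_component) (simp_all add: assms)
    also have "\<dots> = distr ?N borel (indicator A \<circ> (\<lambda>y. y t))"
      using A by (intro distr_distr) auto
    finally show ?thesis by (simp add: o_def)
  qed
  have E: "N.expectation (?X 0) = measure P A"
  proof -
    have "N.expectation (?X 0) = integral\<^sup>L (distr ?N borel (?X 0)) (\<lambda>x. x)"
      by (subst integral_distr) (simp_all add: X)
    also have "\<dots> = measure P A"
      unfolding distr_X using A by (subst integral_distr) simp_all
    finally show ?thesis .
  qed
  have indep: "N.indep_vars (\<lambda>_. borel) ?X UNIV"
  proof (rule N.indep_vars_compose2[where X = "\<lambda>i \<omega>. \<omega> i" and M' = "\<lambda>_. P"])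
    show "N.indep_vars (\<lambda>_. P) (\<lambda>i \<omega>. \<omega> i) UNIV"
      by (rule indep_vars_PiM_components) (simp_all add: assms)
  qed (use A in auto)
  have tail: "N.prob {y \<in> space ?N. \<bar>F n y - measure P A\<bar> \<ge> e} \<le> 2 * exp (- 2 * e\<^sup>2) ^ n"
    if "e > 0" "n > 0" for n e
  proof -
    interpret H: Hoeffding_ineq_iid ?N "{..<n}" ?X "?X 0" 0 1 "N.expectation (?X 0)"
    proof unfold_locales
      show "N.indep_vars (\<lambda>_. borel) ?X {..<n}" using indep by (rule N.indep_vars_subset) simp
      show "distr ?N borel (?X i) = distr ?N borel (?X 0)" for i by (simp only: distr_X)
      show "AE x in ?N. indicator A (x 0) \<in> {0..1::real}" by (auto simp: indicator_def)
    qed (simp_all add: X)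
    have "N.prob {y \<in> space ?N. \<bar>F n y - measure P A\<bar> \<ge> e} \<le> 2 * exp (- 2 * real n * e\<^sup>2)"
      using H.Hoeffding_ineq_abs_ge'[of e] that by (simp add: F_def E lessThan_empty_iff)
    also have "exp (- 2 * real n * e\<^sup>2) = exp (- 2 * e\<^sup>2) ^ n"
      by (simp add: exp_of_nat_mult[symmetric] mult_ac)
    finally show ?thesis .
  qed
  have ev: "AE y in ?N. eventually (\<lambda>n. \<bar>F n y - measure P A\<bar> < e) sequentially" if "e > 0" for e
  proof -
    let ?B = "\<lambda>n. {y \<in> space ?N. \<bar>F n y - measure P A\<bar> \<ge> e}"
    have "summable (\<lambda>n. 2 * exp (- 2 * e\<^sup>2) ^ n)"
      using that by (intro summable_mult summable_geometric) simp
    then have "summable (\<lambda>n. N.prob (?B n))"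
      by (rule summable_comparison_test_ev[rotated])
        (rule eventually_mono[OF eventually_gt_at_top[of 0]], simp add: tail[OF that, simplified])
    then have "AE y in ?N. eventually (\<lambda>n. y \<in> space ?N - ?B n) sequentially"
      by (intro borel_cantelli_AE1) (auto simp: N.emeasure_eq_measure)
    then show ?thesis
      by eventually_elim (auto elim!: eventually_mono)
  qed
  have "AE y in ?N. \<forall>m::nat. eventually (\<lambda>n. \<bar>F n y - measure P A\<bar> < 1 / real (Suc m)) sequentially"
    by (subst AE_all_countable) (auto intro!: ev)
  then show ?thesis
  proof eventually_elim
    case (elim y)
    have "(\<lambda>n. F n y) \<longlonglongrightarrow> measure P A"
    proof (rule tendstoI)
      fix e :: real assume "e > 0"
      then obtain m :: nat where "1 / real (Suc m) < e" using nat_approx_posE by auto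
      then show "eventually (\<lambda>n. dist (F n y) (measure P A) < e) sequentially"
        using elim[rule_format, of m] by (auto simp: dist_real_def elim!: eventually_mono)
    qed
    then show ?case by (simp only: F)
  qed
qed

text \<open>
  The stick containing \<open>y\<close>, cut off at \<open>s\<close>. Stick \<open>i\<close> is the interval from \<open>1 - remaining v i\<close> to
  \<open>1 - remaining v (i + 1)\<close>; counting right ends makes measurability immediate.
\<close>

definition stick_index :: "(nat \<Rightarrow> real) \<Rightarrow> nat \<Rightarrow> real \<Rightarrow> nat" where
  "stick_index v s y = card {i. i < s \<and> 1 - remaining v (Suc i) \<le> y}"

text \<open>The number of blocks is the state of the recursion: each step of the path is cut off at
  the number of blocks that the earlier steps have produced.\<close>

primrec stick_blocks :: "(nat \<Rightarrow> real) \<Rightarrow> (nat \<Rightarrow> real) \<Rightarrow> nat \<Rightarrow> nat" where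
  "stick_blocks v y 0 = 0"
| "stick_blocks v y (Suc t) =
     max (stick_blocks v y t) (Suc (stick_index v (stick_blocks v y t) (y t)))"

definition stick_path :: "(nat \<Rightarrow> real) \<Rightarrow> (nat \<Rightarrow> real) \<Rightarrow> nat \<Rightarrow> nat" where
  "stick_path v y t = stick_index v (stick_blocks v y t) (y t)"

lemma remaining_0 [simp]: "remaining v 0 = 1"
  by (simp add: remaining_def)

lemma remaining_Suc: "remaining v (Suc i) = remaining v i * (1 - v i)"
  by (simp add: remaining_def)

lemma num_blocks_stick_path: "num_blocks (stick_path v y) t = stick_blocks v y t"
  by (induction t) (simp_all add: stick_path_def)

text \<open>As long as the path follows c, its cut-off is the deterministic
  \<open>num_blocks c t\<close>. The event thus becomes a conjunction of conditions on single
  points, to which independence applies.\<close>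

lemma stick_path_prefix:
  "(\<forall>t<n. stick_path v y t = c t) \<longleftrightarrow> (\<forall>t<n. stick_index v (num_blocks c t) (y t) = c t)"
proof (induction n)
  case (Suc n)
  show ?case
  proof (cases "\<forall>t<n. stick_path v y t = c t")
    case True
    then have "num_blocks c n = stick_blocks v y n"
      unfolding num_blocks_stick_path[symmetric] by (intro num_blocks_cong) simp
    then show ?thesis using Suc True by (auto simp: less_Suc_eq stick_path_def)
  next
    case False
    then show ?thesis using Suc by (metis less_Suc_eq)
  qed
qed simp

section \<open>Fixed sticks: frequencies and step probabilities\<close>

context
  fixes v :: "nat \<Rightarrow> real"
  assumes v: "\<And>i. 0 < v i \<and> v i < 1"
begin

lemma remaining_pos: "0 < remaining v i"
  unfolding remaining_def by (rule prod_pos) (simp add: v)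

lemma remaining_antimono: "i \<le> j \<Longrightarrow> remaining v j \<le> remaining v i"
proof (rule lift_Suc_antimono_le)
  fix n
  have "remaining v n * (1 - v n) \<le> remaining v n * 1"
    using v[of n] remaining_pos[of n] by (intro mult_left_mono) auto
  then show "remaining v (Suc n) \<le> remaining v n" by (simp add: remaining_Suc)
qed

lemma remaining_le_1: "remaining v i \<le> 1"
  using remaining_antimono[of 0 i] by simp

text \<open>Right ends increase with the index, so those below y form an initial segment, and their
  number is the index of the stick that contains y. Stick 0 starts at 0, whence the condition on
  y.\<close>

lemma stick_index_eq_iff:
  assumes "0 \<le> y"
  shows "stick_index v s y = x \<longleftrightarrow>
    (x < s \<and> 1 - remaining v x \<le> y \<and> y < 1 - remaining v (Suc x)) \<or>
    (x = s \<and> 1 - remaining v x \<le> y)"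
proof -
  define z where "z = stick_index v s y"
  have ex: "(z < s \<and> 1 - remaining v z \<le> y \<and> y < 1 - remaining v (Suc z)) \<or>
    (z = s \<and> 1 - remaining v z \<le> y)"
  proof -
    define m where "m = (if \<exists>i<s. y < 1 - remaining v (Suc i) then LEAST i. i < s \<and> y < 1 - remaining v (Suc i) else s)"
    have m1: "m < s \<and> y < 1 - remaining v (Suc m)" if ex: "\<exists>i<s. y < 1 - remaining v (Suc i)"
      using LeastI_ex[OF ex] by (simp only: m_def if_P[OF ex])
    have ms: "m = s" if ex: "\<not> (\<exists>i<s. y < 1 - remaining v (Suc i))"
      by (simp only: m_def if_not_P[OF ex])
    have m_le: "m \<le> s"
    proof (cases "\<exists>i<s. y < 1 - remaining v (Suc i)")
      case True
      then show ?thesis using m1 by simp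
    next
      case False
      then show ?thesis using ms by simp
    qed
    have less: "1 - remaining v (Suc i) \<le> y" if "i < m" for i
    proof (rule ccontr)
      assume "\<not> 1 - remaining v (Suc i) \<le> y"
      then have P: "i < s \<and> y < 1 - remaining v (Suc i)" using that m_le by auto
      then have "m \<le> i" unfolding m_def by (auto intro: Least_le)
      then show False using that by simp
    qed
    have ge: "\<not> 1 - remaining v (Suc i) \<le> y" if "m \<le> i" "i < s" for i
    proof -
      have "\<exists>i<s. y < 1 - remaining v (Suc i)"
        by (rule ccontr) (use ms that in simp)
      then have "y < 1 - remaining v (Suc m)" using m1 by simp
      also have "\<dots> \<le> 1 - remaining v (Suc i)" using remaining_antimono[of "Suc m" "Suc i"] that by simp
      finally show ?thesis by simp
    qed
    have "{i. i < s \<and> 1 - remaining v (Suc i) \<le> y} = {..<m}"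
      using less ge m_le by (fastforce simp: not_le)
    then have "z = m" by (simp add: z_def stick_index_def)
    moreover have "1 - remaining v m \<le> y" using less assms by (cases m) auto
    moreover have "m = s \<or> (m < s \<and> y < 1 - remaining v (Suc m))"
      using m1 ms by (cases "\<exists>i<s. y < 1 - remaining v (Suc i)") simp_all
    ultimately show ?thesis by auto
  qed
  have uniq: False if "a < b" "y < 1 - remaining v (Suc a)" "1 - remaining v b \<le> y" for a b
    using that remaining_antimono[of "Suc a" b] by simp
  show ?thesis
    using ex uniq[of z x] uniq[of x z] unfolding z_def[symmetric]
    by (cases x z rule: linorder_cases) auto
qed

context
  fixes y :: "nat \<Rightarrow> real"
  assumes y: "\<And>t. 0 \<le> y t"
    and freq: "\<And>x. (\<lambda>n. real (card {t. t < n \<and> 1 - remaining v x \<le> y t}) / real n) \<longlonglongrightarrow> remaining v x"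
begin

lemma stick_blocks_mono: "t \<le> t' \<Longrightarrow> stick_blocks v y t \<le> stick_blocks v y t'"
  by (rule lift_Suc_mono_le[of "stick_blocks v y"]) simp_all

text \<open>Finitely many such points would have frequency 0, not \<open>remaining v x\<close>,
  which is positive.\<close>

lemma frequently_beyond: "\<exists>t\<ge>T. 1 - remaining v x \<le> y t"
proof (rule ccontr)
  assume "\<not> (\<exists>t\<ge>T. 1 - remaining v x \<le> y t)"
  then have sub: "{t. t < n \<and> 1 - remaining v x \<le> y t} \<subseteq> {..<T}" for n by (auto simp: not_le[symmetric])
  have "(\<lambda>n. real (card {t. t < n \<and> 1 - remaining v x \<le> y t}) / real n) \<longlonglongrightarrow> 0"
  proof (rule tendsto_sandwich[OF _ _ tendsto_const])
    show "(\<lambda>n. real T / real n) \<longlonglongrightarrow> 0" by (rule lim_const_over_n)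
    show "eventually (\<lambda>n. real (card {t. t < n \<and> 1 - remaining v x \<le> y t}) / real n \<le> real T / real n) sequentially"
      using card_mono[OF _ sub] by (intro always_eventually allI divide_right_mono) auto
  qed auto
  from LIMSEQ_unique[OF this freq] show False using remaining_pos[of x] by simp
qed

text \<open>A point beyond all sticks in use opens a block, and such points keep arriving.\<close>

lemma stick_blocks_unbounded: "\<exists>T. x \<le> stick_blocks v y T"
proof (induction x)
  case (Suc x)
  then obtain T where T: "x \<le> stick_blocks v y T" by auto
  define m where "m = stick_blocks v y T"
  obtain t where t: "t \<ge> T" "1 - remaining v m \<le> y t" using frequently_beyond by blast
  have "m \<le> stick_blocks v y t" unfolding m_def by (rule stick_blocks_mono) fact
  then consider "stick_blocks v y t = m" | "Suc m \<le> stick_blocks v y t" by linarith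
  then show ?case
  proof cases
    case 1
    have "stick_index v m (y t) = m" using t y by (subst stick_index_eq_iff) auto
    then have "stick_blocks v y (Suc t) = Suc m" using 1 by simp
    then show ?thesis using T by (intro exI[of _ "Suc t"]) (simp add: m_def)
  next
    case 2
    then show ?thesis using T by (intro exI[of _ t]) (simp add: m_def)
  qed
qed auto

text \<open>Points that arrive before block x exists may be credited to a different block than their
  stick, but this changes the count only by a constant C, which disappears after division by n. What
  is left is the difference of two frequencies, of points beyond the left and beyond the right end
  of stick x.\<close>

lemma stick_path_frequency:
  "(\<lambda>n. real (visits (stick_path v y) n x) / real n) \<longlonglongrightarrow> remaining v x * v x"
proof -
  define F where "F x n = real (card {t. t < n \<and> 1 - remaining v x \<le> y t})" for x n
  have F_Suc: "F x (Suc n) = F x n + (if 1 - remaining v x \<le> y n then 1 else 0)" for x n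
  proof -
    have "{t. t < Suc n \<and> 1 - remaining v x \<le> y t} =
        {t. t < n \<and> 1 - remaining v x \<le> y t} \<union> (if 1 - remaining v x \<le> y n then {n} else {})"
      by (auto simp: less_Suc_eq)
    then show ?thesis by (simp add: F_def)
  qed
  obtain T where T: "Suc x \<le> stick_blocks v y T" using stick_blocks_unbounded by blast
  \<comment> \<open>Once block \<open>x\<close> exists, it grows exactly when the uniform point falls into stick \<open>x\<close>.\<close>
  define C where "C = real (visits (stick_path v y) T x) - (F x T - F (Suc x) T)"
  have eq: "real (visits (stick_path v y) n x) = C + F x n - F (Suc x) n" if "n \<ge> T" for n
    using that
  proof (induction n rule: dec_induct)
    case (step n)
    have "x < stick_blocks v y n" using T stick_blocks_mono[OF step(1)] by simp
    then have "stick_path v y n = x \<longleftrightarrow> 1 - remaining v x \<le> y n \<and> y n < 1 - remaining v (Suc x)"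
      unfolding stick_path_def by (subst stick_index_eq_iff) (auto simp: y)
    then show ?case using step remaining_antimono[of x "Suc x"] by (auto simp: visits_Suc F_Suc)
  qed (simp add: C_def)
  have "(\<lambda>n. C / real n + F x n / real n - F (Suc x) n / real n) \<longlonglongrightarrow>
      0 + remaining v x - remaining v (Suc x)"
    unfolding F_def by (intro tendsto_intros lim_const_over_n freq)
  also have "0 + remaining v x - remaining v (Suc x) = remaining v x * v x"
    by (simp add: remaining_Suc algebra_simps)
  finally show ?thesis
    by (rule Lim_transform_eventually)
      (rule eventually_mono[OF eventually_ge_at_top[of T]], simp add: eq add_divide_distrib diff_divide_distrib)
qed

end

lemma stick_step_nonneg: "0 \<le> stick_step v c t"
  using v[of "c t"] by (auto simp: stick_step_def less_imp_le[OF remaining_pos])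

lemma emeasure_stick_index:
  "emeasure (uniform_measure lborel {0..1}) {y. stick_index v (num_blocks c t) y = c t} =
    ennreal (stick_step v c t)"
proof -
  let ?s = "num_blocks c t" and ?x = "c t"
  have "emeasure (uniform_measure lborel {0..1}) {y. stick_index v ?s y = ?x} =
      emeasure lborel ({0..1::real} \<inter> {y. stick_index v ?s y = ?x}) / emeasure lborel {0..1::real}"
  proof (rule emeasure_uniform_measure)
    have "(\<lambda>y. stick_index v ?s y) \<in> measurable borel (count_space UNIV)"
      unfolding stick_index_def by measurable
    then show "{y. stick_index v ?s y = ?x} \<in> sets lborel" by simp
  qed auto
  also have "{0..1::real} \<inter> {y. stick_index v ?s y = ?x} =
      (if ?x < ?s then {1 - remaining v ?x ..< 1 - remaining v (Suc ?x)}
       else if ?x = ?s then {1 - remaining v ?x .. 1} else {})"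
    using remaining_le_1[of ?x] remaining_pos[of "Suc ?x"] by (auto simp: stick_index_eq_iff)
  also have "emeasure lborel \<dots> = ennreal (stick_step v c t)"
    using remaining_le_1[of ?x] remaining_pos[of ?x] remaining_antimono[of ?x "Suc ?x"]
    by (auto simp: stick_step_def remaining_Suc algebra_simps)
  also have "ennreal (stick_step v c t) / emeasure lborel {0..1::real} = ennreal (stick_step v c t)"
    using stick_step_nonneg by (simp add: divide_ennreal flip: ennreal_1)
  finally show ?thesis .
qed

end


section \<open>The mixture measure on sticks and points\<close>

definition stick_measure :: "nat \<Rightarrow> (nat \<Rightarrow> real) measure" where
  "stick_measure k = PiM UNIV (\<lambda>i. beta_measure (stick_a k) (stick_b k i))"

definition uniform_seq :: "(nat \<Rightarrow> real) measure" where
  "uniform_seq = PiM UNIV (\<lambda>_. uniform_measure lborel {0..1})"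

lemma sets_stick_measure [simp, measurable_cong]: "sets (stick_measure k) = sets (PiM UNIV (\<lambda>_. borel))"
  unfolding stick_measure_def by (rule sets_PiM_cong) simp_all

lemma sets_uniform_seq [simp, measurable_cong]: "sets uniform_seq = sets (PiM UNIV (\<lambda>_. borel))"
  unfolding uniform_seq_def by (rule sets_PiM_cong) simp_all

lemma space_stick_measure [simp]: "space (stick_measure k) = UNIV"
  by (simp add: stick_measure_def space_PiM)

lemma space_uniform_seq [simp]: "space uniform_seq = UNIV"
  by (simp add: uniform_seq_def space_PiM)

lemma prob_space_uniform: "prob_space (uniform_measure lborel {0..1::real})"
  by (rule prob_space_uniform_measure) auto

lemma prob_space_uniform_seq: "prob_space uniform_seq"
  unfolding uniform_seq_def by (intro prob_space_PiM prob_space_uniform)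

lemma prob_space_stick_measure: "k \<ge> 2 \<Longrightarrow> prob_space (stick_measure k)"
  unfolding stick_measure_def by (intro prob_space_PiM prob_space_beta_measure stick_ab_pos)

lemma measurable_remaining:
  "(\<lambda>v. remaining v i) \<in> borel_measurable (PiM UNIV (\<lambda>_. borel))"
  unfolding remaining_def by measurable

abbreviation real_seqs :: "((nat \<Rightarrow> real) \<times> (nat \<Rightarrow> real)) measure" where
  "real_seqs \<equiv> PiM UNIV (\<lambda>_. borel) \<Otimes>\<^sub>M PiM UNIV (\<lambda>_. borel)"

lemma borel_measurable_fst_remaining [measurable]:
  "(\<lambda>\<omega>. remaining (fst \<omega>) i) \<in> borel_measurable real_seqs"
  by (rule measurable_compose[OF measurable_fst measurable_remaining])

lemma borel_measurable_fst_nth [measurable]: "(\<lambda>\<omega>. fst \<omega> i) \<in> borel_measurable real_seqs"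
  by (rule measurable_compose[OF measurable_fst measurable_component_singleton]) simp

lemma borel_measurable_snd_nth [measurable]: "(\<lambda>\<omega>. snd \<omega> t) \<in> borel_measurable real_seqs"
  by (rule measurable_compose[OF measurable_snd measurable_component_singleton]) simp

lemma measurable_stick_index [measurable]:
  "(\<lambda>\<omega>. stick_index (fst \<omega>) s (snd \<omega> t)) \<in> measurable real_seqs (count_space UNIV)"
  unfolding stick_index_def by measurable

lemma measurable_stick_blocks [measurable]:
  "(\<lambda>\<omega>. stick_blocks (fst \<omega>) (snd \<omega>) t) \<in> measurable real_seqs (count_space UNIV)"
proof (induction t)
  case (Suc t)
  note Suc [measurable]
  have [measurable]: "(\<lambda>\<omega>. stick_index (fst \<omega>) (stick_blocks (fst \<omega>) (snd \<omega>) t) (snd \<omega> t)) \<in> measurable real_seqs (count_space UNIV)"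
    by (rule measurable_compose_countable[OF measurable_stick_index Suc])
  show ?case by simp
qed simp

lemma measurable_stick_path [measurable]:
  "(\<lambda>\<omega>. stick_path (fst \<omega>) (snd \<omega>) t) \<in> measurable real_seqs (count_space UNIV)"
  unfolding stick_path_def by (rule measurable_compose_countable[OF measurable_stick_index measurable_stick_blocks])

definition stick_model :: "nat \<Rightarrow> ((nat \<Rightarrow> real) \<times> (nat \<Rightarrow> real)) measure" where
  "stick_model k = stick_measure k \<Otimes>\<^sub>M uniform_seq"

lemma sets_stick_model [simp, measurable_cong]:
  "sets (stick_model k) = sets real_seqs"
  unfolding stick_model_def by (rule sets_pair_measure_cong) simp_all

lemma space_stick_model [simp]: "space (stick_model k) = UNIV"
  by (simp add: stick_model_def space_pair_measure)

lemma AE_stick_measure: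
  assumes "k \<ge> 2"
  shows "AE v in stick_measure k. \<forall>i. 0 < v i \<and> v i < 1"
  unfolding stick_measure_def
  by (subst AE_all_countable, intro allI AE_PiM_component UNIV_I prob_space_beta_measure
      stick_ab_pos assms AE_beta_measure)

text \<open>For fixed sticks the points are independent, which gives the product of
  \<open>stick_step\<close>. Regrouped by stick, it integrates to a product of Beta moments because
  the sticks are independent.\<close>

lemma emeasure_stick_path_prefix:
  assumes k: "k \<ge> 2"
  shows "emeasure (stick_model k) {\<omega>. \<forall>t<n. stick_path (fst \<omega>) (snd \<omega>) t = c t} =
    ennreal (\<Prod>t<n. urn_step k c t)"
proof -
  interpret Y: prob_space uniform_seq by (rule prob_space_uniform_seq)
  interpret Yp: product_prob_space "\<lambda>_. uniform_measure lborel {0..1::real}" "UNIV :: nat set"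
    by (intro product_prob_spaceI prob_space_uniform)
  let ?S = "{\<omega>. \<forall>t<n. stick_path (fst \<omega>) (snd \<omega>) t = c t}"
  have "{\<omega> \<in> space (stick_model k). \<forall>t\<in>{..<n}. stick_path (fst \<omega>) (snd \<omega>) t = c t} \<in> sets (stick_model k)"
    by measurable
  then have S: "?S \<in> sets (stick_model k)" by (simp add: Ball_def)
  have "emeasure (stick_model k) ?S = (\<integral>\<^sup>+v. emeasure uniform_seq (Pair v -` ?S) \<partial>stick_measure k)"
    using S unfolding stick_model_def by (rule Y.emeasure_pair_measure_alt)
  also have "\<dots> = (\<integral>\<^sup>+v. ennreal (\<Prod>t<n. stick_step v c t) \<partial>stick_measure k)"
    using AE_stick_measure[OF k]
  proof (intro nn_integral_cong_AE, eventually_elim)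
    fix v :: "nat \<Rightarrow> real" assume "\<forall>i. 0 < v i \<and> v i < 1"
    then have v: "\<And>i. 0 < v i \<and> v i < 1" by simp
    let ?A = "\<lambda>t. {y. stick_index v (num_blocks c t) y = c t}"
    have A: "?A t \<in> sets (uniform_measure lborel {0..1})" for t
    proof -
      have "(\<lambda>y. stick_index v (num_blocks c t) y) \<in> measurable borel (count_space UNIV)"
        unfolding stick_index_def by measurable
      then show ?thesis by simp
    qed
    have "Pair v -` ?S = {y \<in> space uniform_seq. \<forall>t\<in>{..<n}. y t \<in> ?A t}"
      by (auto simp: stick_path_prefix)
    also have "emeasure uniform_seq \<dots> = (\<Prod>t<n. emeasure (uniform_measure lborel {0..1}) (?A t))"
      unfolding uniform_seq_def by (rule Yp.emeasure_PiM_Collect) (use A in auto)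
    also have "\<dots> = ennreal (\<Prod>t<n. stick_step v c t)"
      using v by (simp add: emeasure_stick_index prod_ennreal stick_step_nonneg)
    finally show "emeasure uniform_seq (Pair v -` ?S) = ennreal (\<Prod>t<n. stick_step v c t)" .
  qed
  also have "\<dots> = ennreal (\<Prod>t<n. urn_step k c t)"
  proof (cases "\<forall>t<n. c t \<le> num_blocks c t")
    case True
    let ?L = "num_blocks c n"
    let ?f = "\<lambda>i x. x ^ (visits c n i - 1) * (1 - x) ^ later_visits c n i :: real"
    have "(\<integral>\<^sup>+v. ennreal (\<Prod>t<n. stick_step v c t) \<partial>stick_measure k) =
        (\<integral>\<^sup>+v. (\<Prod>i<?L. ennreal (?f i (v i))) \<partial>stick_measure k)"
      using AE_stick_measure[OF k]
      by (intro nn_integral_cong_AE, eventually_elim)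
        (subst prod_stick_step[OF _ order.refl], use True in \<open>auto simp: prod_ennreal less_imp_le\<close>)
    also have "\<dots> = (\<Prod>i<?L. \<integral>\<^sup>+x. ennreal (?f i x) \<partial>beta_measure (stick_a k) (stick_b k i))"
      unfolding stick_measure_def
      by (rule nn_integral_PiM_prod) (auto intro!: prob_space_beta_measure stick_ab_pos k)
    also have "\<dots> = (\<Prod>i<?L. ennreal (beta_moment (stick_a k) (stick_b k i) (visits c n i - 1) (later_visits c n i)))"
      by (simp add: nn_integral_beta_measure stick_ab_pos[OF k])
    also have "\<dots> = ennreal (\<Prod>i<?L. beta_moment (stick_a k) (stick_b k i) (visits c n i - 1) (later_visits c n i))"
      using stick_ab_pos[OF k] by (intro prod_ennreal) (simp add: beta_moment_def Beta_pos add_pos_nonneg less_imp_le)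
    also have "(\<Prod>i<?L. beta_moment (stick_a k) (stick_b k i) (visits c n i - 1) (later_visits c n i)) =
        (\<Prod>t<n. urn_step k c t)"
      by (rule prod_beta_moment[OF k]) (use True in auto)
    finally show ?thesis .
  next
    \<comment> \<open>A prefix that skips an index has a vanishing factor in both products.\<close>
    case False
    then obtain t where t: "t < n" "num_blocks c t < c t" by (auto simp: not_le)
    have "(\<Prod>t<n. stick_step v c t) = 0" for v
      using t by (intro prod_zero bexI[of _ t]) (auto simp: stick_step_def)
    moreover have "(\<Prod>t<n. urn_step k c t) = 0"
      using t by (intro prod_zero bexI[of _ t]) (auto simp: urn_step_def)
    ultimately show ?thesis by (simp only: nn_integral_const ennreal_0 mult_zero_left)
  qed
  finally show ?thesis .
qed

lemma measurable_visits_stick_path [measurable]: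
  "(\<lambda>\<omega>. visits (stick_path (fst \<omega>) (snd \<omega>)) n x) \<in> measurable real_seqs (count_space UNIV)"
  unfolding visits_def by measurable

text \<open>By Fubini the sticks may be held fixed. The strong law is then needed only for the
  countably many half-lines starting at the stick ends.\<close>

lemma AE_stick_model_frequency:
  assumes k: "k \<ge> 2"
  shows "AE \<omega> in stick_model k. (\<forall>i. 0 < fst \<omega> i \<and> fst \<omega> i < 1) \<and>
    (\<forall>x. (\<lambda>n. real (visits (stick_path (fst \<omega>) (snd \<omega>)) n x) / real n) \<longlonglongrightarrow>
       remaining (fst \<omega>) x * fst \<omega> x)"
proof -
  interpret A: prob_space "stick_measure k" by (rule prob_space_stick_measure[OF k])
  interpret B: prob_space uniform_seq by (rule prob_space_uniform_seq)
  interpret pair_prob_space "stick_measure k" uniform_seq ..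
  show ?thesis unfolding stick_model_def
  proof (rule AE_pair_measure)
    show "{\<omega> \<in> space (stick_measure k \<Otimes>\<^sub>M uniform_seq). (\<forall>i. 0 < fst \<omega> i \<and> fst \<omega> i < 1) \<and>
      (\<forall>x. (\<lambda>n. real (visits (stick_path (fst \<omega>) (snd \<omega>)) n x) / real n) \<longlonglongrightarrow>
       remaining (fst \<omega>) x * fst \<omega> x)} \<in> sets (stick_measure k \<Otimes>\<^sub>M uniform_seq)"
      by measurable
    show "AE v in stick_measure k. AE y in uniform_seq.
      (\<forall>i. 0 < fst (v, y) i \<and> fst (v, y) i < 1) \<and>
      (\<forall>x. (\<lambda>n. real (visits (stick_path (fst (v, y)) (snd (v, y))) n x) / real n) \<longlonglongrightarrow>
       remaining (fst (v, y)) x * fst (v, y) x)"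
      using AE_stick_measure[OF k]
    proof eventually_elim
      fix v :: "nat \<Rightarrow> real" assume "\<forall>i. 0 < v i \<and> v i < 1"
      then have v: "\<And>i. 0 < v i \<and> v i < 1" by simp
      have meas: "measure (uniform_measure lborel {0..1}) {a..} = 1 - a" if "0 \<le> a" "a \<le> 1" for a :: real
      proof -
        have "measure (uniform_measure lborel {0..1}) {a..} = measure lborel ({0..1} \<inter> {a..})"
          by (subst measure_uniform_measure) auto
        also have "{0..1} \<inter> {a..} = {a..1}" using that by auto
        finally show ?thesis using that by simp
      qed
      have "AE y in uniform_seq. \<forall>x. (\<lambda>n. real (card {t. t < n \<and> 1 - remaining v x \<le> y t}) / real n)
          \<longlonglongrightarrow> remaining v x"
      proof (subst AE_all_countable, rule allI)
        fix x
        show "AE y in uniform_seq. (\<lambda>n. real (card {t. t < n \<and> 1 - remaining v x \<le> y t}) / real n)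
          \<longlonglongrightarrow> remaining v x"
          unfolding uniform_seq_def
          using AE_frequency_tendsto[OF prob_space_uniform, of "{1 - remaining v x..}"]
            meas[of "1 - remaining v x"] remaining_pos[where v = v and i = x, OF v] remaining_le_1[where v = v and i = x, OF v]
          by simp
      qed
      moreover have "AE y in uniform_seq. \<forall>t. 0 \<le> y t"
      proof (subst AE_all_countable, rule allI)
        fix t
        have "AE y in uniform_measure lborel {0..1::real}. 0 \<le> y"
          by (rule AE_uniform_measureI) auto
        then show "AE y in uniform_seq. 0 \<le> y t"
          unfolding uniform_seq_def by (intro AE_PiM_component prob_space_uniform) auto
      qed
      ultimately show "AE y in uniform_seq.
        (\<forall>i. 0 < fst (v, y) i \<and> fst (v, y) i < 1) \<and>
        (\<forall>x. (\<lambda>n. real (visits (stick_path (fst (v, y)) (snd (v, y))) n x) / real n) \<longlonglongrightarrow>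
         remaining (fst (v, y)) x * fst (v, y) x)"
      proof eventually_elim
        case (elim y)
        then show ?case using v by (auto intro!: stick_path_frequency)
      qed
    qed
  qed
qed

section \<open>Transfer to the growth process\<close>

text \<open>The list of the first n entries takes countably many values, so its law is determined by
  the prefix probabilities; every cylinder depends on such a list only.\<close>

lemma measure_eqI_prefixes:
  fixes P Q :: "(nat \<Rightarrow> 'b :: countable) measure"
  assumes sets: "sets P = sets (PiM UNIV (\<lambda>_. count_space UNIV))" "sets Q = sets (PiM UNIV (\<lambda>_. count_space UNIV))"
    and P: "finite_measure P"
    and eq: "\<And>n c. emeasure P {x. \<forall>t<n. x t = c t} = emeasure Q {x. \<forall>t<n. x t = c t}"
  shows "P = Q"
proof (rule measure_eqI_PiM_infinite[OF sets])
  fix A :: "nat \<Rightarrow> 'b set" and J :: "nat set"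
  assume J: "finite J"
  have space: "space P = UNIV" "space Q = UNIV"
    using sets_eq_imp_space_eq[OF sets(1)] sets_eq_imp_space_eq[OF sets(2)] by (simp_all add: space_PiM)
  obtain n where n: "J \<subseteq> {..<n}" using J finite_nat_iff_bounded by blast
  let ?p = "\<lambda>x. map x [0..<n]" and ?C = "count_space UNIV :: 'b list measure"
  have p: "?p \<in> measurable P ?C" "?p \<in> measurable Q ?C"
    unfolding measurable_cong_sets[OF sets(1) refl] measurable_cong_sets[OF sets(2) refl]
    by (rule measurable_map_PiM_count_space, simp)+
  have "distr P ?C ?p = distr Q ?C ?p"
  proof (rule measure_eqI_countable)
    fix l :: "'b list"
    have "map x [0..<n] = l \<longleftrightarrow> length l = n \<and> (\<forall>t<n. x t = l ! t)" for x
      unfolding list_eq_iff_nth_eq by (simp, metis)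
    then have *: "?p -` {l} = (if length l = n then {x. \<forall>t<n. x t = l ! t} else {})"
      by (simp add: vimage_def)
    show "emeasure (distr P ?C ?p) {l} = emeasure (distr Q ?C ?p) {l}"
      using p by (simp add: emeasure_distr space * eq)
  qed auto
  then have "emeasure (distr P ?C ?p) {l. \<forall>j\<in>J. l ! j \<in> A j} = emeasure (distr Q ?C ?p) {l. \<forall>j\<in>J. l ! j \<in> A j}"
    by simp
  moreover have "?p -` {l. \<forall>j\<in>J. l ! j \<in> A j} = prod_emb UNIV (\<lambda>_. count_space UNIV) J (Pi\<^sub>E J A)"
    using n by (auto simp: prod_emb_def PiE_iff subset_eq)
  ultimately show "emeasure P (prod_emb UNIV (\<lambda>_. count_space UNIV) J (Pi\<^sub>E J A)) =
      emeasure Q (prod_emb UNIV (\<lambda>_. count_space UNIV) J (Pi\<^sub>E J A))"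
    using p by (simp add: emeasure_distr space)
qed (rule P)

text \<open>Scheffe's argument: |a - b| = a + b - 2 min(a, b), and the minimum is dominated by y, so
  Tannery's theorem applies to it. Equality of the sums is asked only eventually, since frequencies
  at n = 0 are divisions by zero and sum to 0.\<close>

lemma tendsto_suminf_abs_diff:
  fixes f :: "nat \<Rightarrow> nat \<Rightarrow> real"
  assumes f: "\<And>n i. 0 \<le> f n i" "\<And>n. summable (f n)" "eventually (\<lambda>n. suminf (f n) = s) sequentially"
    and y: "\<And>i. 0 \<le> y i" "y sums s"
    and lim: "\<And>i. (\<lambda>n. f n i) \<longlonglongrightarrow> y i"
  shows "(\<lambda>n. \<Sum>i. \<bar>f n i - y i\<bar>) \<longlonglongrightarrow> 0"
proof -
  have ys: "summable y" "suminf y = s" using y(2) by (auto simp: sums_iff)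
  have "(\<lambda>n. \<Sum>i. min (f n i) (y i)) \<longlonglongrightarrow> suminf y"
  proof (rule tannerys_theorem[THEN conjunct2, THEN conjunct2])
    fix i show "(\<lambda>n. min (f n i) (y i)) \<longlonglongrightarrow> y i"
      using tendsto_min[OF lim tendsto_const, of i "y i"] by simp
  next
    show "eventually (\<lambda>(i, n). norm (min (f n i) (y i)) \<le> y i) (at_top \<times>\<^sub>F sequentially)"
      using f(1) y(1) by (intro always_eventually) auto
  qed (use ys in auto)
  then have "(\<lambda>n. 2 * s - 2 * (\<Sum>i. min (f n i) (y i))) \<longlonglongrightarrow> 2 * s - 2 * s"
    by (intro tendsto_intros) (simp add: ys)
  moreover have "eventually (\<lambda>n. 2 * s - 2 * (\<Sum>i. min (f n i) (y i)) = (\<Sum>i. \<bar>f n i - y i\<bar>)) sequentially"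
    using f(3)
  proof eventually_elim
    case (elim n)
    have m: "summable (\<lambda>i. min (f n i) (y i))"
      by (rule summable_comparison_test'[OF ys(1), of 0]) (use f(1) y(1) in auto)
    have "(\<lambda>i. f n i + y i - 2 * min (f n i) (y i)) sums (s + s - 2 * (\<Sum>i. min (f n i) (y i)))"
      using f(2)[of n] elim m y(2) by (intro sums_diff sums_add sums_mult) (auto simp: sums_iff)
    moreover have "f n i + y i - 2 * min (f n i) (y i) = \<bar>f n i - y i\<bar>" for i
      by (simp add: min_def)
    ultimately show ?case by (simp add: sums_iff)
  qed
  ultimately show ?thesis by (simp add: Lim_transform_eventually)
qed

text \<open>Using \<open>lim\<close> gives a total measurable function of the path; paths without
  these limits will turn out to have probability 0.\<close>

definition path_limit :: "(nat \<Rightarrow> nat) \<Rightarrow> nat \<Rightarrow> real" where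
  "path_limit c i = lim (\<lambda>n. real (visits c n i) / real n)"

text \<open>The inverse of stick breaking: the denominator is the length left over by the earlier
  blocks. Applied to the growth path, it supplies the Beta variables of the theorem.\<close>

definition path_stick :: "(nat \<Rightarrow> nat) \<Rightarrow> nat \<Rightarrow> real" where
  "path_stick c i = path_limit c i / (1 - (\<Sum>j<i. path_limit c j))"

abbreviation nat_seqs :: "(nat \<Rightarrow> nat) measure" where
  "nat_seqs \<equiv> PiM UNIV (\<lambda>_. count_space UNIV)"

lemma measurable_visits [measurable]: "(\<lambda>c. visits c n i) \<in> measurable nat_seqs (count_space UNIV)"
proof -
  have [measurable]: "(\<lambda>c. c r) \<in> measurable nat_seqs (count_space UNIV)" for r :: nat
    by (rule measurable_component_singleton) simp
  show ?thesis unfolding visits_def by measurable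
qed

lemma borel_measurable_path_stick [measurable]: "(\<lambda>c. path_stick c i) \<in> borel_measurable nat_seqs"
  unfolding path_stick_def path_limit_def by measurable

lemma measurable_path_stick: "path_stick \<in> measurable nat_seqs (PiM UNIV (\<lambda>_. borel))"
  by (rule measurable_PiM_single') (auto simp: borel_measurable_path_stick)

lemma sum_stick: "(\<Sum>j<i. remaining v j * v j) = 1 - remaining v i"
  by (induction i) (simp_all add: remaining_Suc algebra_simps)

lemma path_stick_eq:
  assumes "\<And>i. 0 < v i \<and> v i < 1"
    and lim: "\<And>x. (\<lambda>n. real (visits c n x) / real n) \<longlonglongrightarrow> remaining v x * v x"
  shows "path_stick c = v"
proof
  fix i
  have "path_limit c x = remaining v x * v x" for x
    unfolding path_limit_def using lim by (rule limI)
  then show "path_stick c i = v i"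
    using remaining_pos[where v = v and i = i, OF assms(1)] by (simp add: path_stick_def sum_stick)
qed

text \<open>The factors are independent with means (i + 2)/(k + i + 1), so the expected remaining
  length tends to 0. Hence its infimum has integral 0 and vanishes almost everywhere, and by
  monotonicity the infimum is the limit.\<close>

lemma AE_remaining_tendsto_0:
  assumes k: "k \<ge> 2"
  shows "AE v in stick_measure k. remaining v \<longlonglongrightarrow> 0"
proof -
  have m: "(\<integral>\<^sup>+v. ennreal (remaining v n) \<partial>stick_measure k) \<le> ennreal (2 / real (n + 2))" for n
  proof -
    have "(\<integral>\<^sup>+v. ennreal (remaining v n) \<partial>stick_measure k) =
        (\<integral>\<^sup>+v. (\<Prod>i<n. ennreal (v i ^ 0 * (1 - v i) ^ 1)) \<partial>stick_measure k)"
      using AE_stick_measure[OF k]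
      by (intro nn_integral_cong_AE, eventually_elim) (simp add: remaining_def prod_ennreal less_imp_le)
    also have "\<dots> = (\<Prod>i<n. \<integral>\<^sup>+x. ennreal (x ^ 0 * (1 - x) ^ 1) \<partial>beta_measure (stick_a k) (stick_b k i))"
      unfolding stick_measure_def
      by (rule nn_integral_PiM_prod) (auto intro!: prob_space_beta_measure stick_ab_pos k)
    also have "\<dots> = (\<Prod>i<n. ennreal (beta_moment (stick_a k) (stick_b k i) 0 1))"
      by (simp only: nn_integral_beta_measure stick_ab_pos[OF k])
    also have "\<dots> = (\<Prod>i<n. ennreal ((real i + 2) / (real k + real i + 1)))"
    proof (intro prod.cong refl arg_cong[where f = ennreal])
      fix i
      have "beta_moment (stick_a k) (stick_b k i) 0 1 = stick_b k i / (stick_a k + stick_b k i)"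
        using beta_moment_Suc_right[OF stick_ab_pos[OF k], of i 0 0] beta_moment_0_0[OF stick_ab_pos[OF k], of i]
        by simp
      also have "stick_a k + stick_b k i = (real k + real i + 1) / real k"
        using k by (simp add: stick_a_def stick_b_def field_simps)
      also have "stick_b k i / ((real k + real i + 1) / real k) = (real i + 2) / (real k + real i + 1)"
        using k by (simp add: stick_b_def)
      finally show "beta_moment (stick_a k) (stick_b k i) 0 1 = (real i + 2) / (real k + real i + 1)" .
    qed
    also have "\<dots> = ennreal (\<Prod>i<n. (real i + 2) / (real k + real i + 1))" by (rule prod_ennreal) simp
    \<comment> \<open>The case k = 2 is the worst one, and there the product telescopes.\<close>
    also have "\<dots> \<le> ennreal (\<Prod>i<n. real (i + 2) / real (i + 3))"
      using k by (intro ennreal_leI prod_mono conjI frac_le) auto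
    also have "(\<Prod>i<n. real (i + 2) / real (i + 3)) = 2 / real (n + 2)"
      by (induction n) (simp_all add: field_simps)
    finally show ?thesis .
  qed
  have [measurable]: "(\<lambda>v. remaining v n) \<in> borel_measurable (stick_measure k)" for n
    using measurable_remaining by simp
  let ?G = "\<lambda>v. INF n. ennreal (remaining v n)"
  have "(\<integral>\<^sup>+v. ?G v \<partial>stick_measure k) = 0"
  proof -
    have "(\<integral>\<^sup>+v. ?G v \<partial>stick_measure k) \<le> ennreal (2 / real (n + 2))" for n
      by (rule order.trans[OF nn_integral_mono m]) (rule INF_lower, simp)
    moreover have "(\<lambda>n. ennreal (2 / real (n + 2))) \<longlonglongrightarrow> ennreal 0"
      by (intro tendsto_ennrealI, rule LIMSEQ_ignore_initial_segment[where f = "\<lambda>n. 2 / real n"]) (rule lim_const_over_n)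
    ultimately have "(\<integral>\<^sup>+v. ?G v \<partial>stick_measure k) \<le> ennreal 0"
      by (intro LIMSEQ_le_const) auto
    then show ?thesis by simp
  qed
  then have "AE v in stick_measure k. ?G v = 0"
    by (subst (asm) nn_integral_0_iff_AE) auto
  then show ?thesis using AE_stick_measure[OF k]
  proof eventually_elim
    case (elim v)
    then have v: "\<And>i. 0 < v i \<and> v i < 1" by simp
    show "remaining v \<longlonglongrightarrow> 0"
    proof (rule tendstoI)
      fix e :: real assume "e > 0"
      then have "?G v < ennreal e" using elim(1) by simp
      then obtain n where "ennreal (remaining v n) < ennreal e" by (auto simp: INF_less_iff)
      then have n: "remaining v n < e"
        using remaining_pos[where v = v, OF v] by (simp add: ennreal_less_iff less_imp_le)
      have "dist (remaining v m) 0 < e" if "n \<le> m" for m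
        using remaining_antimono[where v = v, OF v that] remaining_pos[where v = v and i = m, OF v] n by simp
      then show "eventually (\<lambda>m. dist (remaining v m) 0 < e) sequentially"
        by (auto simp: eventually_sequentially)
    qed
  qed
qed

text \<open>Everything is expressed through the path alone, so that this is an event of the path
  space and its probability depends only on the law of the path.\<close>

definition regular_path :: "(nat \<Rightarrow> nat) \<Rightarrow> bool" where
  "regular_path c \<longleftrightarrow>
     (\<forall>x. (\<lambda>n. real (visits c n x) / real n) \<longlonglongrightarrow> remaining (path_stick c) x * path_stick c x) \<and>
     (\<forall>i. 0 < path_stick c i \<and> path_stick c i < 1) \<and> remaining (path_stick c) \<longlonglongrightarrow> 0"

lemma AE_stick_model_regular:
  assumes k: "k \<ge> 2"
  shows "AE \<omega> in stick_model k. path_stick (stick_path (fst \<omega>) (snd \<omega>)) = fst \<omega> \<and>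
    regular_path (stick_path (fst \<omega>) (snd \<omega>))"
proof -
  interpret B: prob_space uniform_seq by (rule prob_space_uniform_seq)
  have "AE v in distr (stick_model k) (stick_measure k) fst. remaining v \<longlonglongrightarrow> 0"
    unfolding stick_model_def B.distr_pair_fst by (rule AE_remaining_tendsto_0[OF k])
  then have "AE \<omega> in stick_model k. remaining (fst \<omega>) \<longlonglongrightarrow> 0"
    by (rule AE_distrD[rotated]) (simp add: stick_model_def)
  then show ?thesis using AE_stick_model_frequency[OF k]
  proof eventually_elim
    case (elim \<omega>)
    then have "path_stick (stick_path (fst \<omega>) (snd \<omega>)) = fst \<omega>" by (intro path_stick_eq) auto
    then show ?case using elim by (simp add: regular_path_def)
  qed
qed

lemma measurable_stick_path_seq:
  "(\<lambda>\<omega>. stick_path (fst \<omega>) (snd \<omega>)) \<in> measurable (stick_model k) nat_seqs"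
  by (rule measurable_PiM_single') (simp_all add: measurable_stick_path measurable_cong_sets[OF sets_stick_model refl])

lemma sets_regular_path: "{c \<in> space nat_seqs. regular_path c} \<in> sets nat_seqs"
proof -
  have [measurable]: "(\<lambda>c. remaining (path_stick c) x) \<in> borel_measurable nat_seqs" for x
    by (rule measurable_compose[OF measurable_path_stick measurable_remaining])
  show ?thesis unfolding regular_path_def by measurable
qed

text \<open>Each step visits exactly one block, so for n > 0 the frequencies sum to 1; the limits do
  so because the remaining length tends to 0.\<close>

lemma regular_path_tendsto_l1:
  assumes c: "regular_path c"
  shows "(\<lambda>n. \<Sum>i. \<bar>real (visits c n i) / real n - remaining (path_stick c) i * path_stick c i\<bar>) \<longlonglongrightarrow> 0"
    and "summable (\<lambda>i. real (visits c n i) / real n)"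
    and "(\<lambda>i. remaining (path_stick c) i * path_stick c i) sums 1"
proof -
  let ?v = "path_stick c"
  have v: "\<And>i. 0 < ?v i \<and> ?v i < 1" using c by (simp add: regular_path_def)
  have s: "(\<lambda>i. real (visits c n i) / real n) sums (\<Sum>i<num_blocks c n. real (visits c n i) / real n)" for n
  proof (rule sums_finite)
    fix i assume "i \<notin> {..<num_blocks c n}"
    then have "visits c n i = 0" using less_num_blocks[of _ n c] by (auto simp: visits_eq_0_iff)
    then show "real (visits c n i) / real n = 0" by simp
  qed simp
  then show sm: "summable (\<lambda>i. real (visits c n i) / real n)" for n by (rule sums_summable)
  have tot: "(\<Sum>i. real (visits c n i) / real n) = 1" if "n > 0" for n
  proof -
    have "(\<Sum>i. real (visits c n i) / real n) = real (\<Sum>i<num_blocks c n. visits c n i) / real n"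
      using s[of n] by (simp add: sums_iff sum_divide_distrib)
    also have "(\<Sum>i<num_blocks c n. visits c n i) = n"
      by (rule sum_visits) (rule less_num_blocks)
    finally show ?thesis using that by simp
  qed
  have "(\<lambda>i. 1 - remaining ?v i) \<longlonglongrightarrow> 1 - 0"
    using c by (intro tendsto_intros) (simp add: regular_path_def)
  then show y: "(\<lambda>i. remaining ?v i * ?v i) sums 1"
    by (simp add: sums_def sum_stick)
  show "(\<lambda>n. \<Sum>i. \<bar>real (visits c n i) / real n - remaining ?v i * ?v i\<bar>) \<longlonglongrightarrow> 0"
  proof (rule tendsto_suminf_abs_diff[OF _ sm _ _ y])
    show "eventually (\<lambda>n. (\<Sum>i. real (visits c n i) / real n) = 1) sequentially"
      using eventually_gt_at_top[of 0] by eventually_elim (rule tot)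
    show "0 \<le> remaining ?v i * ?v i" for i
      using remaining_pos[where v = ?v and i = i, OF v] v[of i] by (simp add: less_imp_le)
    show "(\<lambda>n. real (visits c n i) / real n) \<longlonglongrightarrow> remaining ?v i * ?v i" for i
      using c by (simp add: regular_path_def)
  qed simp
qed

lemma stick_breaking_shift: "stick_breaking (\<lambda>m. v (m - 1)) (Suc i) = remaining v i * v i"
proof -
  have "(\<Prod>j\<in>{1..<Suc i}. 1 - v (j - 1)) = (\<Prod>j<i. 1 - v j)"
    by (rule prod.reindex_bij_witness[of _ Suc "\<lambda>j. j - 1"]) auto
  then show ?thesis by (simp add: stick_breaking_def remaining_def)
qed

section \<open>Law of the recovered sticks on the given space\<close>

context stirling_process
begin

lemma distr_path:
  "distr M nat_seqs block_path = distr (stick_model k) nat_seqs (\<lambda>\<omega>. stick_path (fst \<omega>) (snd \<omega>))"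
proof (rule measure_eqI_prefixes)
  interpret D: prob_space "distr M nat_seqs block_path" by (rule prob_space_distr) (rule measurable_path)
  show "finite_measure (distr M nat_seqs block_path)" by unfold_locales
  fix n and c :: "nat \<Rightarrow> nat"
  have "{x \<in> space nat_seqs. \<forall>t\<in>{..<n}. x t = c t} \<in> sets nat_seqs" by measurable
  then have S: "{x. \<forall>t<n. x t = c t} \<in> sets nat_seqs" by (simp add: space_PiM Ball_def)
  have "emeasure (distr M nat_seqs block_path) {x. \<forall>t<n. x t = c t} = emeasure M {\<omega> \<in> space M. \<forall>t<n. block_path \<omega> t = c t}"
    using S measurable_path by (simp add: emeasure_distr vimage_def Int_def conj_commute)
  also have "\<dots> = ennreal (\<Prod>t<n. urn_step k c t)"
    by (simp add: emeasure_eq_measure prob_path_prefix)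
  also have "\<dots> = emeasure (distr (stick_model k) nat_seqs (\<lambda>\<omega>. stick_path (fst \<omega>) (snd \<omega>))) {x. \<forall>t<n. x t = c t}"
    using S measurable_stick_path_seq by (simp add: emeasure_distr vimage_def emeasure_stick_path_prefix[OF k_ge_2])
  finally show "emeasure (distr M nat_seqs block_path) {x. \<forall>t<n. x t = c t} =
    emeasure (distr (stick_model k) nat_seqs (\<lambda>\<omega>. stick_path (fst \<omega>) (snd \<omega>))) {x. \<forall>t<n. x t = c t}" .
qed simp_all

lemma AE_regular_path: "AE \<omega> in M. regular_path (block_path \<omega>)"
proof -
  have "AE \<omega> in stick_model k. regular_path (stick_path (fst \<omega>) (snd \<omega>))"
    using AE_stick_model_regular[OF k_ge_2] by eventually_elim simp
  then have "AE c in distr M nat_seqs block_path. regular_path c"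
    unfolding distr_path by (subst AE_distr_iff[OF measurable_stick_path_seq sets_regular_path])
  then show ?thesis by (subst (asm) AE_distr_iff[OF measurable_path sets_regular_path])
qed

lemma measurable_path_stick_path: "(\<lambda>\<omega>. path_stick (block_path \<omega>)) \<in> measurable M (PiM UNIV (\<lambda>_. borel))"
  by (rule measurable_compose[OF measurable_path measurable_path_stick])

text \<open>Equality of path laws moves the computation to the mixture, where
  \<open>path_stick\<close> returns the original sticks almost surely.\<close>

lemma distr_path_stick: "distr M (PiM UNIV (\<lambda>_. borel)) (\<lambda>\<omega>. path_stick (block_path \<omega>)) = stick_measure k"
proof -
  interpret B: prob_space uniform_seq by (rule prob_space_uniform_seq)
  let ?R = "PiM UNIV (\<lambda>_. borel) :: (nat \<Rightarrow> real) measure"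
  have "distr M ?R (\<lambda>\<omega>. path_stick (block_path \<omega>)) = distr (distr M nat_seqs block_path) ?R path_stick"
    by (simp add: distr_distr[OF measurable_path_stick measurable_path] o_def)
  also have "\<dots> = distr (stick_model k) ?R (\<lambda>\<omega>. path_stick (stick_path (fst \<omega>) (snd \<omega>)))"
    unfolding distr_path by (simp add: distr_distr[OF measurable_path_stick measurable_stick_path_seq] o_def)
  also have "\<dots> = distr (stick_model k) ?R fst"
  proof (rule distr_cong_AE)
    show "AE \<omega> in stick_model k. path_stick (stick_path (fst \<omega>) (snd \<omega>)) = fst \<omega>"
      using AE_stick_model_regular[OF k_ge_2] by eventually_elim simp
    show "(\<lambda>\<omega>. path_stick (stick_path (fst \<omega>) (snd \<omega>))) \<in> measurable (stick_model k) ?R"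
      by (rule measurable_compose[OF measurable_stick_path_seq measurable_path_stick])
    show "fst \<in> measurable (stick_model k) ?R"
      by (simp add: measurable_cong_sets[OF sets_stick_model refl])
  qed simp_all
  also have "\<dots> = distr (stick_model k) (stick_measure k) fst"
    by (rule distr_cong) simp_all
  also have "\<dots> = stick_measure k"
    unfolding stick_model_def by (rule B.distr_pair_fst)
  finally show ?thesis .
qed

lemma block_size_path:
  assumes "n > 0"
  shows "real (block_size (stirling_growth k (\<lambda>m. U m \<omega>) n) (Suc i)) / real (k * n) =
    real (visits (block_path \<omega>) n i) / real n"
  using assms k_ge_2 by (simp add: block_size_growth block_path_def)

lemma distr_path_stick_component:
  "distr M borel (\<lambda>\<omega>. path_stick (block_path \<omega>) i) = beta_measure (stick_a k) (stick_b k i)"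
proof -
  have "distr M borel (\<lambda>\<omega>. path_stick (block_path \<omega>) i) =
      distr (distr M (PiM UNIV (\<lambda>_. borel)) (\<lambda>\<omega>. path_stick (block_path \<omega>))) borel (\<lambda>v. v i)"
    by (subst distr_distr) (auto simp: o_def measurable_path_stick_path)
  also have "\<dots> = distr (stick_measure k) (beta_measure (stick_a k) (stick_b k i)) (\<lambda>v. v i)"
    unfolding distr_path_stick by (rule distr_cong) simp_all
  also have "\<dots> = beta_measure (stick_a k) (stick_b k i)"
    unfolding stick_measure_def
    by (rule distr_PiM_component) (auto intro!: prob_space_beta_measure stick_ab_pos k_ge_2)
  finally show ?thesis .
qed

text \<open>The joint law is a product measure, and it stays one when reindexed along m - 1, which
  is injective on {1..}.\<close>

lemma indep_path_stick: "indep_vars (\<lambda>_. borel) (\<lambda>m \<omega>. path_stick (block_path \<omega>) (m - 1)) {1..}"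
proof (subst indep_vars_iff_distr_eq_PiM')
  let ?B = "\<lambda>i. beta_measure (stick_a k) (stick_b k i)"
  let ?R = "PiM {1..} (\<lambda>_. borel) :: (nat \<Rightarrow> real) measure"
  show "(\<lambda>\<omega>. path_stick (block_path \<omega>) (m - 1)) \<in> measurable M borel" for m
    by (rule measurable_compose[OF measurable_path borel_measurable_path_stick])
  have r: "(\<lambda>v. \<lambda>m\<in>{1..}. v (m - 1)) \<in> measurable (PiM UNIV (\<lambda>_. borel)) ?R"
    by (rule measurable_restrict) simp
  have "distr M ?R (\<lambda>\<omega>. \<lambda>m\<in>{1..}. path_stick (block_path \<omega>) (m - 1)) =
      distr (distr M (PiM UNIV (\<lambda>_. borel)) (\<lambda>\<omega>. path_stick (block_path \<omega>))) ?R (\<lambda>v. \<lambda>m\<in>{1..}. v (m - 1))"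
    by (subst distr_distr[OF r measurable_path_stick_path]) (simp add: o_def)
  also have "\<dots> = distr (stick_measure k) (PiM {1..} (\<lambda>m. ?B (m - 1))) (\<lambda>v. \<lambda>m\<in>{1..}. v (m - 1))"
    unfolding distr_path_stick by (rule distr_cong) (auto intro!: sets_PiM_cong)
  also have "\<dots> = PiM {1..} (\<lambda>m. ?B (m - 1))"
    unfolding stick_measure_def
    by (rule distr_PiM_reindex) (auto intro!: prob_space_beta_measure stick_ab_pos k_ge_2 simp: inj_on_def)
  finally show "distr M ?R (\<lambda>\<omega>. \<lambda>m\<in>{1..}. path_stick (block_path \<omega>) (m - 1)) =
      PiM {1..} (\<lambda>m. distr M borel (\<lambda>\<omega>. path_stick (block_path \<omega>) (m - 1)))"
    by (simp add: distr_path_stick_component)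
qed simp

lemma distributed_path_stick:
  assumes "m \<ge> 1"
  shows "distributed M lborel (\<lambda>\<omega>. path_stick (block_path \<omega>) (m - 1))
    (\<lambda>x. ennreal (beta_density ((real k - 1) / real k) ((real m + 1) / real k) x))"
proof -
  have ab: "stick_a k = (real k - 1) / real k" "stick_b k (m - 1) = (real m + 1) / real k"
    using assms by (simp_all add: stick_a_def stick_b_def of_nat_diff)
  have meas: "(\<lambda>\<omega>. path_stick (block_path \<omega>) (m - 1)) \<in> measurable M borel"
    by (rule measurable_compose[OF measurable_path borel_measurable_path_stick])
  have "distr M lborel (\<lambda>\<omega>. path_stick (block_path \<omega>) (m - 1)) = distr M borel (\<lambda>\<omega>. path_stick (block_path \<omega>) (m - 1))"
    by (rule distr_cong) simp_all
  also have "\<dots> = density lborel (\<lambda>x. ennreal (beta_density ((real k - 1) / real k) ((real m + 1) / real k) x))"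
    by (simp only: distr_path_stick_component beta_measure_def ab)
  finally show ?thesis using meas by (simp add: distributed_def)
qed

lemma regular_path_block_sizes:
  assumes c: "regular_path (block_path \<omega>)"
  defines "K \<equiv> \<lambda>n i. real (block_size (stirling_growth k (\<lambda>m. U m \<omega>) n) i) / real (k * n)"
    and "\<beta> \<equiv> \<lambda>m. path_stick (block_path \<omega>) (m - 1)"
  shows "\<forall>i\<ge>1. (\<lambda>n. K n i) \<longlonglongrightarrow> stick_breaking \<beta> i" and "tendsto_l1 K (stick_breaking \<beta>)"
proof -
  \<comment> \<open>For n = 0 both sides are divisions by zero and hence 0.\<close>
  have K: "K n (Suc i) = real (visits (block_path \<omega>) n i) / real n" for n i
    using block_size_path[of n \<omega> i] by (cases "n = 0") (simp_all add: K_def)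
  have y: "stick_breaking \<beta> (Suc i) = remaining (path_stick (block_path \<omega>)) i * path_stick (block_path \<omega>) i" for i
    unfolding \<beta>_def by (rule stick_breaking_shift)
  have "(\<lambda>n. K n (Suc i)) \<longlonglongrightarrow> stick_breaking \<beta> (Suc i)" for i
    using c by (simp add: K y regular_path_def)
  then show "\<forall>i\<ge>1. (\<lambda>n. K n i) \<longlonglongrightarrow> stick_breaking \<beta> i"
    by (metis One_nat_def Suc_le_D)
  have "0 \<le> remaining (path_stick (block_path \<omega>)) i * path_stick (block_path \<omega>) i" for i
  proof -
    have v: "\<And>i. 0 < path_stick (block_path \<omega>) i \<and> path_stick (block_path \<omega>) i < 1"
      using c by (simp add: regular_path_def)
    show ?thesis using remaining_pos[where v = "path_stick (block_path \<omega>)" and i = i, OF v] v[of i]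
      by (simp add: less_imp_le)
  qed
  then show "tendsto_l1 K (stick_breaking \<beta>)"
    unfolding tendsto_l1_def K y
    using regular_path_tendsto_l1[OF c] by (simp add: abs_of_nonneg sums_iff)
qed

end

theorem theorem7p1:
  fixes k :: nat and M :: "'a measure" and U :: "nat \<Rightarrow> 'a \<Rightarrow> nat"
    and K :: "nat \<Rightarrow> nat \<Rightarrow> 'a \<Rightarrow> nat"
  assumes "k \<ge> 2"
    and "prob_space M"
    and "prob_space.indep_vars M (\<lambda>_. count_space UNIV) U {1..}"
    and "\<And>n. n \<ge> 1 \<Longrightarrow>
           distr M (count_space UNIV) (U n) = measure_pmf (pmf_of_set {0..k * n})"
    and "\<And>n i \<omega>. K n i \<omega> = block_size (stirling_growth k (\<lambda>m. U m \<omega>) n) i"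
  shows "\<exists>\<beta> :: nat \<Rightarrow> 'a \<Rightarrow> real.
           prob_space.indep_vars M (\<lambda>_. borel) \<beta> {1..} \<and>
           (\<forall>m\<ge>1. distributed M lborel (\<beta> m)
              (\<lambda>x. ennreal (beta_density ((real k - 1) / real k) ((real m + 1) / real k) x))) \<and>
           (AE \<omega> in M.
              (\<forall>i\<ge>1. (\<lambda>n. real (K n i \<omega>) / real (k * n))
                 \<longlonglongrightarrow> stick_breaking (\<lambda>m. \<beta> m \<omega>) i) \<and>
              tendsto_l1 (\<lambda>n i. real (K n i \<omega>) / real (k * n))
                 (stick_breaking (\<lambda>m. \<beta> m \<omega>)))"
proof -
  interpret stirling_process M k U
    using assms(1-4) by (simp add: stirling_process_def stirling_process_axioms_def)
  let ?\<beta> = "\<lambda>m \<omega>. path_stick (block_path \<omega>) (m - 1)"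
  have "AE \<omega> in M.
      (\<forall>i\<ge>1. (\<lambda>n. real (K n i \<omega>) / real (k * n)) \<longlonglongrightarrow> stick_breaking (\<lambda>m. ?\<beta> m \<omega>) i) \<and>
      tendsto_l1 (\<lambda>n i. real (K n i \<omega>) / real (k * n)) (stick_breaking (\<lambda>m. ?\<beta> m \<omega>))"
    using AE_regular_path unfolding assms(5)
    by eventually_elim (intro conjI regular_path_block_sizes)
  then show ?thesis
    using indep_path_stick distributed_path_stick by (intro exI[of _ ?\<beta>] conjI) auto
qed

end
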